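(* For every graph $G$, $\chi_{DP}(G)\le\omega(G)+i(G)$. Moreover, if $G$ is non-chordal and $K_n$-minor-free, then $\chi_{DP}(G)\le n-2+i(G)$.
   Context: All graphs are finite and simple; $\omega$ is the clique number and $\chi_{DP}$ the DP-chromatic (correspondence chromatic) number. A hole of $G$ is an induced cycle of length at least $4$; $G$ is chordal if it has no hole. $\mathcal H(G)$ is the set of holes and $\mathcal H(G,u)$ those containing $u$. A hole cover of $G$ is a nonempty $X\subseteq V(G)$ meeting every hole (any nonempty set if $G$ is chordal). A vertex $u$ satisfies the NC property in $G$ if there are no holes $H\in\mathcal H(G,u)$, $H'\in\mathcal H(G)\setminus\mathcal H(G,u)$ sharing two consecutive edges (two distinct edges with a common end vertex lying on both). A set $\mathcal C$ satisfies the NC property in $G$ if each of its vertices does and every hole contains at most one vertex of $\mathcal C$. Locally chordalizing all holes in $\mathcal H(G,u)$ by $u$ means adding all edges $uw$ with $w\ne u$ lying on some hole in $\mathcal H(G,u)$. For a hole cover $\mathcal C=\{u_1,\dots,u_k\}$ satisfying the NC property in $G$, set $G_0=G$, obtain $G_i$ from $G_{i-1}$ by locally chordalizing all holes in $\mathcal H(G_{i-1},u_i)$ by $u_i$, and put $\widehat G(\mathcal C)=G_k$ (independent of the ordering). Given a hole cover $\mathcal C$ of $G$, an ordered partition $(\mathcal C_1,\dots,\mathcal C_\ell)$ of $\mathcal C$ into nonempty parts is a local chordalization partition if, with $G_0=G_0^*=G-\mathcal C$ and, for $i=1,\dots,\ell$, $G_i$ the graph with $V(G_i)=V(G_{i-1}^*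 )\cup\mathcal C_i$ and $E(G_i)=E(G_{i-1}^* )\cup E\big(G-\bigcup_{j=i+1}^{\ell}\mathcal C_j\big)$ and $G_i^*=\widehat{G_i}(\mathcal C_i)$, each $\mathcal C_i$ is a hole cover of $G_i$ satisfying the NC property in $G_i$ and each $G_i^*$ is chordal. The non-chordality index $i(G)$ is $0$ if $G$ is chordal and otherwise the smallest $\ell$ such that some hole cover of $G$ admits a local chordalization partition with $\ell$ parts. *)

theory Defs
  imports Main
begin

type_synonym 'a graph = "'a set \<times> 'a set set"

definition verts :: "'a graph \<Rightarrow> 'a set" where "verts G = fst G"
definition edges :: "'a graph \<Rightarrow> 'a set set" where "edges G = snd G"

definition wf_graph :: "'a graph \<Rightarrow> bool" where
  "wf_graph G \<longleftrightarrow> finite (verts G) \<and>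
     (\<forall>e\<in>edges G. \<exists>u v. e = {u, v} \<and> u \<noteq> v \<and> u \<in> verts G \<and> v \<in> verts G)"

definition adj :: "'a graph \<Rightarrow> 'a \<Rightarrow> 'a \<Rightarrow> bool" where
  "adj G u v \<longleftrightarrow> u \<noteq> v \<and> {u, v} \<in> edges G"

definition delete :: "'a graph \<Rightarrow> 'a set \<Rightarrow> 'a graph" where
  "delete G S = (verts G - S, {e \<in> edges G. e \<inter> S = {}})"

definition is_hole :: "'a graph \<Rightarrow> 'a set \<Rightarrow> bool" where
  "is_hole G H \<longleftrightarrow> (\<exists>xs. distinct xs \<and> set xs = H \<and> H \<subseteq> verts G \<and> length xs \<ge> 4 \<and>
      (\<forall>i<length xs. \<forall>j<length xs.
          adj G (xs ! i) (xs ! j) \<longleftrightarrow>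
            (j = Suc i mod length xs \<or> i = Suc j mod length xs)))"

text \<open>The edges of a hole H (the edges of G with both ends in H, as H is induced).\<close>
definition hole_edges :: "'a graph \<Rightarrow> 'a set \<Rightarrow> 'a set set" where
  "hole_edges G H = {e \<in> edges G. e \<subseteq> H}"

definition chordal :: "'a graph \<Rightarrow> bool" where
  "chordal G \<longleftrightarrow> \<not> (\<exists>H. is_hole G H)"

definition hole_cover :: "'a graph \<Rightarrow> 'a set \<Rightarrow> bool" where
  "hole_cover G X \<longleftrightarrow> X \<noteq> {} \<and> X \<subseteq> verts G \<and> (\<forall>H. is_hole G H \<longrightarrow> H \<inter> X \<noteq> {})"

definition NC_vertex :: "'a graph \<Rightarrow> 'a \<Rightarrow> bool" where
  "NC_vertex G u \<longleftrightarrow> \<not> (\<exists>H H' e1 e2. is_hole G H \<and> u \<in> H \<and> is_hole G H' \<and> u \<notin> H' \<and>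
      e1 \<noteq> e2 \<and> e1 \<inter> e2 \<noteq> {} \<and>
      e1 \<in> hole_edges G H \<and> e2 \<in> hole_edges G H \<and>
      e1 \<in> hole_edges G H' \<and> e2 \<in> hole_edges G H')"

definition NC_set :: "'a graph \<Rightarrow> 'a set \<Rightarrow> bool" where
  "NC_set G C \<longleftrightarrow> (\<forall>u\<in>C. NC_vertex G u) \<and> (\<forall>H. is_hole G H \<longrightarrow> card (H \<inter> C) \<le> 1)"

definition local_chordalize :: "'a graph \<Rightarrow> 'a \<Rightarrow> 'a graph" where
  "local_chordalize G u =
     (verts G, edges G \<union> {{u, w} | w. w \<noteq> u \<and> (\<exists>H. is_hole G H \<and> u \<in> H \<and> w \<in> H)})"

text \<open>\<open>\<widehat>G(C)\<close>: locally chordalize successively by the vertices of C in some ordering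
  (the result is independent of the ordering when C is a hole cover with the NC property).\<close>
definition hatG :: "'a graph \<Rightarrow> 'a set \<Rightarrow> 'a graph" where
  "hatG G C = (let xs = (SOME xs. distinct xs \<and> set xs = C) in
               foldl local_chordalize G xs)"

text \<open>Conditions of a local chordalization partition, processed part by part.
  Arguments: the original graph G, the current graph \<open>G*_{i-1}\<close>, the remaining parts.\<close>
fun lcp_steps :: "'a graph \<Rightarrow> 'a graph \<Rightarrow> 'a set list \<Rightarrow> bool" where
  "lcp_steps G Gs [] = True"
| "lcp_steps G Gs (C # Cs) =
     (let Gi = (verts Gs \<union> C, edges Gs \<union> edges (delete G (\<Union> (set Cs))));
          Gi' = hatG Gi C
      in hole_cover Gi C \<and> NC_set Gi C \<and> chordal Gi' \<and> lcp_steps G Gi' Cs)"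

definition local_chordalization_partition :: "'a graph \<Rightarrow> 'a set \<Rightarrow> 'a set list \<Rightarrow> bool" where
  "local_chordalization_partition G C Cs \<longleftrightarrow>
     Cs \<noteq> [] \<and> (\<forall>D\<in>set Cs. D \<noteq> {}) \<and> \<Union> (set Cs) = C \<and>
     (\<forall>i<length Cs. \<forall>j<length Cs. i \<noteq> j \<longrightarrow> Cs ! i \<inter> Cs ! j = {}) \<and>
     lcp_steps G (delete G C) Cs"

definition non_chordality_index :: "'a graph \<Rightarrow> nat" where
  "non_chordality_index G =
     (if chordal G then 0
      else (LEAST l. \<exists>C Cs. hole_cover G C \<and> local_chordalization_partition G C Cs \<and> length Cs = l))"

definition is_clique :: "'a graph \<Rightarrow> 'a set \<Rightarrow> bool" where
  "is_clique G K \<longleftrightarrow> K \<subseteq> verts G \<and> (\<forall>u\<in>K. \<forall>v\<in>K. u \<noteq> v \<longrightarrow> adj G u v)"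

definition clique_number :: "'a graph \<Rightarrow> nat" where
  "clique_number G = Max {card K | K. is_clique G K}"

text \<open>DP-colouring. A k-fold cover assigns to each vertex v the list {(v,0),...,(v,k-1)};
  \<open>M u v i j\<close> says (u,i) and (v,j) are adjacent in the cover; for each edge uv these
  adjacencies form a matching (symmetric, at most one partner per colour).\<close>
definition dp_cover :: "'a graph \<Rightarrow> nat \<Rightarrow> ('a \<Rightarrow> 'a \<Rightarrow> nat \<Rightarrow> nat \<Rightarrow> bool) \<Rightarrow> bool" where
  "dp_cover G k M \<longleftrightarrow>
     (\<forall>u v i j. M u v i j \<longleftrightarrow> M v u j i) \<and>
     (\<forall>u v i j j'. adj G u v \<and> i < k \<and> j < k \<and> j' < k \<and> M u v i j \<and> M u v i j' \<longrightarrow> j = j')"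

definition dp_colorable :: "'a graph \<Rightarrow> nat \<Rightarrow> bool" where
  "dp_colorable G k \<longleftrightarrow> (\<forall>M. dp_cover G k M \<longrightarrow>
     (\<exists>f. (\<forall>v\<in>verts G. f v < k) \<and> (\<forall>u v. adj G u v \<longrightarrow> \<not> M u v (f u) (f v))))"

definition chi_DP :: "'a graph \<Rightarrow> nat" where
  "chi_DP G = (LEAST k. dp_colorable G k)"

definition connected_set :: "'a graph \<Rightarrow> 'a set \<Rightarrow> bool" where
  "connected_set G S \<longleftrightarrow>
     (\<forall>u\<in>S. \<forall>v\<in>S. (\<lambda>x y. x \<in> S \<and> y \<in> S \<and> adj G x y)\<^sup>*\<^sup>* u v)"

definition has_K_minor :: "'a graph \<Rightarrow> nat \<Rightarrow> bool" where
  "has_K_minor G n \<longleftrightarrow> (\<exists>B :: nat \<Rightarrow> 'a set.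
     (\<forall>i<n. B i \<noteq> {} \<and> B i \<subseteq> verts G \<and> connected_set G (B i)) \<and>
     (\<forall>i<n. \<forall>j<n. i \<noteq> j \<longrightarrow> B i \<inter> B j = {} \<and> (\<exists>x\<in>B i. \<exists>y\<in>B j. adj G x y)))"

end

theory Submission
  imports Defs
begin

text \<open>Every \<open>G\<^sub>i\<^sup>*\<close> is chordal, so \<open>G\<close> is a subgraph of a chordal graph \<open>G\<^sub>l\<^sup>*\<close>, and a chordal graph is greedily
  DP-colourable with as many colours as its largest clique, along a simplicial elimination order.
  It remains to bound the cliques of \<open>G\<^sub>l\<^sup>*\<close>. The NC property implies that local chordalization by \<open>u\<close>
  destroys the holes through \<open>u\<close> and creates no new ones; hence \<open>\<widehat>G(C)\<close> arises from \<open>G\<close> by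
  adding the edges \<open>uw\<close> with \<open>u \<in> C\<close> and \<open>w\<close> on a hole of \<open>G\<close> through \<open>u\<close>. Every clique of \<open>\<widehat>G(C)\<close>
  becomes a clique of \<open>G\<close> after removing one vertex, since otherwise some hole would contain two
  vertices of \<open>C\<close>. Iterating, a clique of \<open>G\<^sub>i\<^sup>*\<close> becomes a clique of \<open>G\<close> after removing \<open>i\<close> vertices.
  For the minor version no vertex need be lost in the first step: the removed vertex together with
  pieces of the holes through it forms a branch set adjacent to the rest of the clique.\<close>

section \<open>Adjacency in finite simple graphs\<close>

lemma adj_sym: "adj G u v \<Longrightarrow> adj G v u"
  by (auto simp: adj_def insert_commute)

lemma adj_commute: "adj G u v \<longleftrightarrow> adj G v u"
  by (auto intro: adj_sym)

lemma adj_irrefl [simp]: "\<not> adj G u u"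
  by (simp add: adj_def)

lemma wf_graph_adjD:
  assumes "wf_graph G" "adj G u v"
  shows "u \<in> verts G" "v \<in> verts G"
proof -
  have e: "{u, v} \<in> edges G" using assms(2) by (simp add: adj_def)
  then obtain x y where "{u, v} = {x, y}" "x \<in> verts G" "y \<in> verts G"
    using assms(1) unfolding wf_graph_def by blast
  then show "u \<in> verts G" "v \<in> verts G" by (auto simp: doubleton_eq_iff)
qed

subsection \<open>Connected sets and induced paths\<close>

definition anticomplete :: "'a graph \<Rightarrow> 'a set \<Rightarrow> 'a set \<Rightarrow> bool" where
  "anticomplete G A B \<longleftrightarrow> A \<inter> B = {} \<and> (\<forall>x\<in>A. \<forall>y\<in>B. \<not> adj G x y)"

lemma anticomplete_sym: "anticomplete G A B \<Longrightarrow> anticomplete G B A"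
  by (auto simp: anticomplete_def dest: adj_sym)

lemma connected_set_singleton [simp]: "connected_set G {x}"
  by (auto simp: connected_set_def)

lemma connected_set_empty [simp]: "connected_set G {}"
  by (auto simp: connected_set_def)

lemma rtranclp_within_mono:
  assumes "(\<lambda>x y. x \<in> S \<and> y \<in> S \<and> adj G x y)\<^sup>*\<^sup>* u v" "S \<subseteq> T"
  shows "(\<lambda>x y. x \<in> T \<and> y \<in> T \<and> adj G x y)\<^sup>*\<^sup>* u v"
  using assms by (auto elim!: rtranclp_mono[THEN predicate2D, rotated])

lemma connected_set_union:
  assumes "connected_set G A" "connected_set G B" "x \<in> A" "y \<in> B" "x = y \<or> adj G x y"
  shows "connected_set G (A \<union> B)"
proof -
  let ?R = "\<lambda>x y. x \<in> A \<union> B \<and> y \<in> A \<union> B \<and> adj G x y"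
  have A: "?R\<^sup>*\<^sup>* u v" if "u \<in> A" "v \<in> A" for u v
    using assms(1) that rtranclp_within_mono[of A G u v "A \<union> B"] by (auto simp: connected_set_def)
  have B: "?R\<^sup>*\<^sup>* u v" if "u \<in> B" "v \<in> B" for u v
    using assms(2) that rtranclp_within_mono[of B G u v "A \<union> B"] by (auto simp: connected_set_def)
  have xy: "?R\<^sup>*\<^sup>* x y" "?R\<^sup>*\<^sup>* y x"
    using assms(3-5) adj_sym[of G x y] by auto
  show ?thesis unfolding connected_set_def
  proof (intro ballI)
    fix u v assume u: "u \<in> A \<union> B" and v: "v \<in> A \<union> B"
    have "?R\<^sup>*\<^sup>* u x" "?R\<^sup>*\<^sup>* x v"
      using u v A B assms(3,4) xy by (blast intro: rtranclp_trans)+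
    then show "?R\<^sup>*\<^sup>* u v" by (rule rtranclp_trans)
  qed
qed

lemma connected_set_insert:
  assumes "connected_set G A" "x \<in> A" "adj G y x"
  shows "connected_set G (insert y A)"
  using connected_set_union[of G "{y}" A y x] assms by simp

lemma connected_set_not_anticomplete_union:
  assumes "connected_set G A" "connected_set G B" "\<not> anticomplete G A B"
  shows "connected_set G (A \<union> B)"
  using assms connected_set_union[of G A B] by (fastforce simp: anticomplete_def)

lemma connected_set_Union_common:
  assumes "\<And>A. A \<in> \<A> \<Longrightarrow> connected_set G A \<and> x \<in> A"
  shows "connected_set G (\<Union>\<A>)"
  unfolding connected_set_def
proof (intro ballI)
  fix u v assume "u \<in> \<Union>\<A>" "v \<in> \<Union>\<A>"
  then obtain A B where AB: "A \<in> \<A>" "u \<in> A" "B \<in> \<A>" "v \<in> B" by blast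
  have "connected_set G (A \<union> B)"
    using assms AB by (intro connected_set_union[of G A B x x]) auto
  then have "(\<lambda>x y. x \<in> A \<union> B \<and> y \<in> A \<union> B \<and> adj G x y)\<^sup>*\<^sup>* u v"
    using AB by (auto simp: connected_set_def)
  then show "(\<lambda>x y. x \<in> \<Union>\<A> \<and> y \<in> \<Union>\<A> \<and> adj G x y)\<^sup>*\<^sup>* u v"
    by (rule rtranclp_within_mono) (use AB in blast)
qed

text \<open>A walk inside \<open>W\<close> that starts in \<open>L\<close> never leaves
  \<open>L\<close>, since no edge crosses to \<open>R\<close>. This is how a hole constructed later
  is shown to use a middle piece.\<close>

lemma connected_set_not_separated:
  assumes "connected_set G W" "W \<subseteq> L \<union> R" "anticomplete G L R" "x \<in> W \<inter> L" "y \<in> W \<inter> R"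
  shows False
proof -
  have "(\<lambda>x y. x \<in> W \<and> y \<in> W \<and> adj G x y)\<^sup>*\<^sup>* x y"
    using assms(1,4,5) by (auto simp: connected_set_def)
  then have "y \<in> L"
    by (induction rule: rtranclp_induct) (use assms(2-4) in \<open>auto simp: anticomplete_def\<close>)
  then show False using assms(3,5) by (auto simp: anticomplete_def)
qed

text \<open>Stated by indices to line up with \<open>is_hole\<close>, with the wrap-around modulo
  the length dropped. Empty and one-vertex lists are allowed, as they arise from \<open>take\<close>
  and \<open>drop\<close>.\<close>

definition induced_path :: "'a graph \<Rightarrow> 'a list \<Rightarrow> bool" where
  "induced_path G xs \<longleftrightarrow> distinct xs \<and>
     (\<forall>i<length xs. \<forall>j<length xs. adj G (xs ! i) (xs ! j) \<longleftrightarrow> j = Suc i \<or> i = Suc j)"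

lemma successively_connected_set:
  assumes "successively (adj G) xs"
  shows "connected_set G (set xs)"
  using assms
proof (induction xs rule: induct_list012)
  case (3 x y zs)
  then show ?case using connected_set_insert[of G "set (y # zs)" y x] by simp
qed auto

lemma induced_path_successively: "induced_path G xs \<Longrightarrow> successively (adj G) xs"
  by (auto simp: induced_path_def successively_conv_nth)

lemma induced_path_take: "induced_path G xs \<Longrightarrow> induced_path G (take k xs)"
  by (auto simp: induced_path_def)

lemma induced_path_drop: "induced_path G xs \<Longrightarrow> induced_path G (drop k xs)"
  by (auto simp: induced_path_def)

lemma induced_path_connected: "induced_path G xs \<Longrightarrow> connected_set G (set xs)"
  by (simp add: induced_path_successively successively_connected_set)

lemma walk_exists:
  assumes "connected_set G W" "x \<in> W" "y \<in> W"
  shows "\<exists>xs. xs \<noteq> [] \<and> hd xs = x \<and> last xs = y \<and> set xs \<subseteq> W \<and> successively (adj G) xs"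
proof -
  have "(\<lambda>x y. x \<in> W \<and> y \<in> W \<and> adj G x y)\<^sup>*\<^sup>* x y"
    using assms by (auto simp: connected_set_def)
  then show ?thesis
  proof (induction rule: rtranclp_induct)
    case base
    show ?case by (rule exI[of _ "[x]"]) (use assms in auto)
  next
    case (step y z)
    then obtain xs where "xs \<noteq> []" "hd xs = x" "last xs = y" "set xs \<subseteq> W" "successively (adj G) xs"
      by blast
    then show ?case using step
      by (intro exI[of _ "xs @ [z]"]) (auto simp: successively_append_iff)
  qed
qed

text \<open>A walk of minimal length works: a repeated vertex or a chord would give a shorter walk
  with the same ends.\<close>

lemma induced_path_exists:
  assumes "connected_set G W" "x \<in> W" "y \<in> W"
  obtains xs where "induced_path G xs" "xs \<noteq> []" "hd xs = x" "last xs = y" "set xs \<subseteq> W"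
proof -
  let ?P = "\<lambda>xs. xs \<noteq> [] \<and> hd xs = x \<and> last xs = y \<and> set xs \<subseteq> W \<and> successively (adj G) xs"
  obtain xs where xs: "?P xs" and min: "\<And>ys. ?P ys \<Longrightarrow> length xs \<le> length ys"
    using ex_has_least_nat[of ?P _ length] walk_exists[OF assms] by metis
  have short: "\<not> (i < j \<and> (xs ! i = xs ! j \<or> adj G (xs ! i) (xs ! j) \<and> Suc i < j))"
    if j: "j < length xs" for i j
  proof
    assume ij: "i < j \<and> (xs ! i = xs ! j \<or> adj G (xs ! i) (xs ! j) \<and> Suc i < j)"
    \<comment> \<open>A chord keeps position \<open>j\<close>; a repetition must skip it as well,
      because \<open>xs ! i\<close> already stands for that vertex.\<close>
    define k where "k = (if xs ! i = xs ! j then Suc j else j)"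
    define ys where "ys = take (Suc i) xs @ drop k xs"
    have i: "i < length xs" using ij j by simp
    have tk: "take (Suc i) xs \<noteq> []" "last (take (Suc i) xs) = xs ! i"
      using i by (auto simp: take_Suc_conv_app_nth)
    have "hd ys = x" using xs i tk unfolding ys_def by (simp add: hd_append)
    \<comment> \<open>If nothing remains after \<open>k\<close>, the repeated vertex was the last
      one, so the initial piece already ends in \<open>y\<close>.\<close>
    moreover have "last ys = y"
    proof (cases "k < length xs")
      case True
      then show ?thesis using xs by (simp add: ys_def last_append)
    next
      case False
      then have "xs ! i = xs ! j" "Suc j = length xs" using j by (auto simp: k_def split: if_splits)
      then have "xs ! i = last xs" using xs by (metis diff_Suc_1 last_conv_nth)
      then show ?thesis using False tk xs by (simp add: ys_def)
    qed
    moreover have "set ys \<subseteq> W"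
      using xs set_take_subset[of "Suc i" xs] set_drop_subset[of k xs] by (auto simp: ys_def)
    moreover have "successively (adj G) ys"
    proof -
      have "successively (adj G) (take (Suc i) xs)" "successively (adj G) (drop k xs)"
        using xs by (auto simp: successively_conv_nth)
      moreover have "adj G (last (take (Suc i) xs)) (hd (drop k xs))" if "drop k xs \<noteq> []"
      proof -
        have k: "k < length xs" using that by simp
        show ?thesis
        proof (cases "xs ! i = xs ! j")
          case True
          then have "adj G (xs ! j) (xs ! Suc j)"
            using xs k by (auto simp: successively_conv_nth k_def)
          then show ?thesis using True k tk by (simp add: k_def hd_drop_conv_nth)
        next
          case False
          then show ?thesis using ij k tk by (simp add: k_def hd_drop_conv_nth)
        qed
      qed
      ultimately show ?thesis using tk by (auto simp: ys_def successively_append_iff)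
    qed
    moreover have "ys \<noteq> []" using tk by (simp add: ys_def)
    ultimately have "length xs \<le> length ys" using min by blast
    then show False using ij j i by (auto simp: ys_def k_def split: if_splits)
  qed
  have "distinct xs"
    unfolding distinct_conv_nth using short by (metis linorder_neqE_nat)
  moreover have "adj G (xs ! i) (xs ! j) \<longleftrightarrow> j = Suc i \<or> i = Suc j"
    if "i < length xs" "j < length xs" for i j
  proof
    assume a: "adj G (xs ! i) (xs ! j)"
    then have "i \<noteq> j" by auto
    then show "j = Suc i \<or> i = Suc j"
      using short[of j i] short[of i j] that a adj_sym[OF a] by linarith
  next
    assume "j = Suc i \<or> i = Suc j"
    then show "adj G (xs ! i) (xs ! j)"
      using xs that by (auto simp: successively_conv_nth adj_commute)
  qed
  ultimately have "induced_path G xs" by (auto simp: induced_path_def)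
  then show ?thesis using that xs by blast
qed

subsection \<open>Holes\<close>

text \<open>Cutting a hole at \<open>u\<close> turns the cyclic order into a linear one. The
  arithmetic modulo the length is confined to this lemma and \<open>holeE\<close>.\<close>

lemma holeI:
  assumes "induced_path G xs" "length xs \<ge> 3" "u \<notin> set xs" "insert u (set xs) \<subseteq> verts G"
    and "\<And>i. i < length xs \<Longrightarrow> adj G u (xs ! i) \<longleftrightarrow> i = 0 \<or> Suc i = length xs"
  shows "is_hole G (insert u (set xs))"
  unfolding is_hole_def
proof (intro exI[of _ "u # xs"] conjI allI impI)
  let ?ys = "u # xs"
  fix i j assume i: "i < length ?ys" and j: "j < length ?ys"
  have u': "adj G (xs ! i) u \<longleftrightarrow> i = 0 \<or> Suc i = length xs" if "i < length xs" for i
    using assms(5)[OF that] by (simp add: adj_commute)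
  show "adj G (?ys ! i) (?ys ! j) \<longleftrightarrow>
      j = Suc i mod length ?ys \<or> i = Suc j mod length ?ys"
    using i j assms(1,2) assms(5) u'
    by (cases i; cases j) (auto simp: induced_path_def mod_Suc)
qed (use assms in \<open>auto simp: induced_path_def\<close>)

text \<open>The cyclic list is rotated until \<open>u\<close> comes first; the tail is the required
  path.\<close>

lemma holeE:
  assumes "is_hole G H" "u \<in> H"
  obtains xs where "induced_path G xs" "length xs \<ge> 3" "u \<notin> set xs" "H = insert u (set xs)"
    "\<And>i. i < length xs \<Longrightarrow> adj G u (xs ! i) \<longleftrightarrow> i = 0 \<or> Suc i = length xs"
proof -
  obtain ys where ys: "distinct ys" "set ys = H" "length ys \<ge> 4"
    and a: "\<And>i j. i < length ys \<Longrightarrow> j < length ys \<Longrightarrow> adj G (ys ! i) (ys ! j) \<longleftrightarrow>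
            (j = Suc i mod length ys \<or> i = Suc j mod length ys)"
    using assms(1) unfolding is_hole_def by blast
  obtain k where k: "k < length ys" "ys ! k = u" using assms(2) ys by (metis in_set_conv_nth)
  define n where "n = length ys"
  define zs where "zs = rotate k ys"
  have zn: "zs ! i = ys ! ((k + i) mod n)" if "i < n" for i
    using that by (simp add: zs_def nth_rotate n_def)
  have len: "length zs = n" by (simp add: zs_def n_def)
  have md: "(k + i) mod n = (if k + i < n then k + i else k + i - n)" if "i < n" for i
    using that k by (auto simp: n_def le_mod_geq)
  have za: "adj G (zs ! i) (zs ! j) \<longleftrightarrow> (j = Suc i mod n \<or> i = Suc j mod n)"
    if i: "i < n" and j: "j < n" for i j
  proof -
    have "adj G (zs ! i) (zs ! j) \<longleftrightarrow> ((k + j) mod n = Suc ((k + i) mod n) mod n \<or>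
       (k + i) mod n = Suc ((k + j) mod n) mod n)"
      using i j a[of "(k + i) mod n" "(k + j) mod n", folded n_def] by (simp add: zn)
    \<comment> \<open>Rotation commutes with the cyclic successor.\<close>
    moreover have "(k + j) mod n = Suc ((k + i) mod n) mod n \<longleftrightarrow> j = Suc i mod n"
      if i: "i < n" and j: "j < n" for i j
      using i j k(1) n_def unfolding mod_Suc md[OF i] md[OF j] by (auto split: if_splits)
    ultimately show ?thesis using i j by simp
  qed
  obtain xs where xs: "zs = u # xs"
  proof (cases zs)
    case Nil
    then show ?thesis using len ys n_def by simp
  next
    case (Cons x xs)
    have "zs ! 0 = u" using zn[of 0] k unfolding n_def by fastforce
    then show ?thesis using Cons that by simp
  qed
  have n: "n = Suc (length xs)" using len xs by simp
  have "distinct zs" "set zs = H" using ys by (auto simp: zs_def)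
  moreover have "adj G (xs ! i) (xs ! j) \<longleftrightarrow> j = Suc i \<or> i = Suc j"
    if "i < length xs" "j < length xs" for i j
    using za[of "Suc i" "Suc j"] that n by (auto simp: xs mod_Suc split: if_splits)
  moreover have "adj G u (xs ! i) \<longleftrightarrow> i = 0 \<or> Suc i = length xs" if "i < length xs" for i
    using za[of 0 "Suc i"] that n by (auto simp: xs mod_Suc split: if_splits)
  ultimately show ?thesis using that[of xs] xs n ys n_def by (auto simp: induced_path_def)
qed

text \<open>Close a shortest path from \<open>x\<close> to \<open>y\<close> inside \<open>W\<close> by \<open>z\<close>.\<close>

lemma hole_through:
  assumes "connected_set G W" "x \<in> W" "y \<in> W" "x \<noteq> y" "\<not> adj G x y" "z \<notin> W"
    and N: "\<And>w. w \<in> W \<Longrightarrow> adj G z w \<longleftrightarrow> w = x \<or> w = y"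
    and V: "insert z W \<subseteq> verts G"
  obtains H where "is_hole G H" "H \<subseteq> insert z W" "x \<in> H" "y \<in> H" "z \<in> H"
    "connected_set G (H - {z})"
proof -
  obtain xs where xs: "induced_path G xs" "xs \<noteq> []" "hd xs = x" "last xs = y" "set xs \<subseteq> W"
    using induced_path_exists[OF assms(1-3)] by blast
  have d: "distinct xs" using xs by (simp add: induced_path_def)
  have x0: "xs ! 0 = x" using xs by (simp add: hd_conv_nth)
  have yl: "xs ! (length xs - 1) = y" using xs by (simp add: last_conv_nth)
  have pos: "0 < length xs" using xs by simp
  have l1: "length xs \<noteq> 1" using x0 yl assms(4) by auto
  have l2: "length xs \<noteq> 2"
  proof
    assume l: "length xs = 2"
    then have "adj G (xs ! 0) (xs ! 1)" using xs(1) by (auto simp: induced_path_def)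
    then show False using x0 yl l assms(5) by simp
  qed
  have l3: "3 \<le> length xs" using pos l1 l2 by linarith
  have z: "z \<notin> set xs" using xs assms(6) by blast
  have "is_hole G (insert z (set xs))"
  proof (rule holeI[OF xs(1) l3 z])
    show "insert z (set xs) \<subseteq> verts G" using V xs by blast
    fix i assume i: "i < length xs"
    then have "adj G z (xs ! i) \<longleftrightarrow> xs ! i = xs ! 0 \<or> xs ! i = xs ! (length xs - 1)"
      using N[of "xs ! i"] xs(5) x0 yl by (metis nth_mem subsetD)
    also have "\<dots> \<longleftrightarrow> i = 0 \<or> i = length xs - 1"
      using i d pos by (simp add: nth_eq_iff_index_eq)
    finally show "adj G z (xs ! i) \<longleftrightarrow> i = 0 \<or> Suc i = length xs" using pos by auto
  qed
  moreover have "insert z (set xs) - {z} = set xs" using z by auto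
  moreover have "x \<in> set xs" "y \<in> set xs" using xs by auto
  ultimately show ?thesis using that[of "insert z (set xs)"] xs induced_path_connected[OF xs(1)] by auto
qed

text \<open>Without \<open>u\<close> the hole is an induced path with \<open>w\<close> in its
  interior; the sides are the pieces before and after \<open>w\<close>. The singletons record that
  \<open>u\<close> and \<open>w\<close> have one neighbour on each side, the form needed by
  \<open>hole_through\<close>. On a side with one vertex the two neighbours coincide.\<close>

lemma hole_sides:
  assumes "is_hole G T" "u \<in> T" "w \<in> T" "u \<noteq> w" "\<not> adj G u w"
  obtains A B s t x y where "T = insert u (insert w (A \<union> B))" "u \<notin> A \<union> B" "w \<notin> A \<union> B"
    "connected_set G A" "connected_set G B" "anticomplete G A B"
    "{z \<in> A. adj G u z} = {s}" "{z \<in> B. adj G u z} = {t}"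
    "{z \<in> A. adj G w z} = {x}" "{z \<in> B. adj G w z} = {y}"
proof -
  obtain xs where xs: "induced_path G xs" "length xs \<ge> 3" "u \<notin> set xs" "T = insert u (set xs)"
    and N: "\<And>i. i < length xs \<Longrightarrow> adj G u (xs ! i) \<longleftrightarrow> i = 0 \<or> Suc i = length xs"
    using holeE[OF assms(1,2)] by metis
  have d: "distinct xs" using xs by (simp add: induced_path_def)
  have e: "\<And>i j. i < length xs \<Longrightarrow> j < length xs \<Longrightarrow> xs ! i = xs ! j \<longleftrightarrow> i = j"
    using d by (simp add: nth_eq_iff_index_eq)
  have a: "\<And>i j. i < length xs \<Longrightarrow> j < length xs \<Longrightarrow> adj G (xs ! i) (xs ! j) \<longleftrightarrow> j = Suc i \<or> i = Suc j"
    using xs(1) by (simp add: induced_path_def)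
  obtain k where k: "k < length xs" "xs ! k = w"
    using assms(3,4) xs by (metis in_set_conv_nth insertE)
  \<comment> \<open>Only the two ends of the path are adjacent to \<open>u\<close>, so
    \<open>w\<close> is not an end and both sides are nonempty.\<close>
  have k0: "0 < k" "Suc k < length xs" using N[OF k(1)] k assms(5) by auto
  define A where "A = (!) xs ` {i. i < k}"
  define B where "B = (!) xs ` {i. k < i \<and> i < length xs}"
  have A: "A = set (take k xs)" using k(1) by (simp add: A_def nth_image[symmetric] lessThan_def[symmetric] atLeast0LessThan)
  have "B \<subseteq> set (drop (Suc k) xs)"
  proof
    fix z assume "z \<in> B"
    then obtain i where "z = xs ! i" "k < i" "i < length xs" by (auto simp: B_def)
    then have "z = drop (Suc k) xs ! (i - Suc k)" "i - Suc k < length (drop (Suc k) xs)" by auto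
    then show "z \<in> set (drop (Suc k) xs)" by (metis nth_mem)
  qed
  moreover have "set (drop (Suc k) xs) \<subseteq> B"
    by (auto simp: B_def set_conv_nth)
  ultimately have B: "B = set (drop (Suc k) xs)" by blast
  have set: "set xs = insert w (A \<union> B)"
  proof -
    have "set xs = (!) xs ` {i. i < length xs}" by (auto simp: set_conv_nth)
    also have "{i. i < length xs} = insert k ({i. i < k} \<union> {i. k < i \<and> i < length xs})" using k by auto
    finally show ?thesis using k by (simp add: A_def B_def image_Un)
  qed
  show ?thesis
  proof (rule that[of A B "xs ! 0" "xs ! (length xs - 1)" "xs ! (k - 1)" "xs ! Suc k"])
    show "T = insert u (insert w (A \<union> B))" using set xs by simp
    show "u \<notin> A \<union> B" using set xs by auto
    show "w \<notin> A \<union> B" using k e by (fastforce simp: A_def B_def)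
    show "connected_set G A" "connected_set G B"
      using xs(1) by (simp_all add: A B induced_path_connected induced_path_take induced_path_drop)
    show "anticomplete G A B"
      using k e a by (fastforce simp: anticomplete_def A_def B_def)
    have filter_image: "{z \<in> f ` I. P z} = {f k}" if "{i \<in> I. P (f i)} = {k}"
      for f :: "nat \<Rightarrow> 'a" and I P k
    proof -
      have "{z \<in> f ` I. P z} = f ` {i \<in> I. P (f i)}" by auto
      then show ?thesis using that by simp
    qed
    have "i \<in> {i \<in> {i. i < k}. adj G u (xs ! i)} \<longleftrightarrow> i \<in> {0}" for i
      using N[of i] k0 by (cases "i < k") auto
    then show "{z \<in> A. adj G u z} = {xs ! 0}"
      unfolding A_def by (intro filter_image) (rule set_eqI)
    have "i \<in> {i \<in> {i. k < i \<and> i < length xs}. adj G u (xs ! i)} \<longleftrightarrow> i \<in> {length xs - 1}" for i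
      using N[of i] k0 by (cases "k < i \<and> i < length xs") auto
    then show "{z \<in> B. adj G u z} = {xs ! (length xs - 1)}"
      unfolding B_def by (intro filter_image) (rule set_eqI)
    have "i \<in> {i \<in> {i. i < k}. adj G w (xs ! i)} \<longleftrightarrow> i \<in> {k - 1}" for i
      using a[OF k(1), of i] k k0 by (cases "i < k") auto
    then show "{z \<in> A. adj G w z} = {xs ! (k - 1)}"
      unfolding A_def by (intro filter_image) (rule set_eqI)
    have "i \<in> {i \<in> {i. k < i \<and> i < length xs}. adj G w (xs ! i)} \<longleftrightarrow> i \<in> {Suc k}" for i
      using a[OF k(1), of i] k k0 by (cases "k < i \<and> i < length xs") auto
    then show "{z \<in> B. adj G w z} = {xs ! Suc k}"
      unfolding B_def by (intro filter_image) (rule set_eqI)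
  qed
qed

subsection \<open>Local chordalization at a vertex\<close>

text \<open>Two consecutive edges are described by their common end \<open>a\<close> and their other
  ends \<open>x\<close>, \<open>y\<close>, so that the property can be contradicted by naming three
  vertices.\<close>

lemma NC_vertexD:
  assumes "NC_vertex G u" "is_hole G T" "u \<in> T" "is_hole G H" "adj G a x" "adj G a y" "x \<noteq> y"
    and "a \<in> T" "x \<in> T" "y \<in> T" "a \<in> H" "x \<in> H" "y \<in> H"
  shows "u \<in> H"
proof (rule ccontr)
  assume "u \<notin> H"
  moreover have "{a, x} \<noteq> {a, y}" "{a, x} \<inter> {a, y} \<noteq> {}"
    using assms(7) by (auto simp: doubleton_eq_iff)
  moreover have "{a, x} \<in> hole_edges G T" "{a, y} \<in> hole_edges G T"
    "{a, x} \<in> hole_edges G H" "{a, y} \<in> hole_edges G H"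
    using assms by (auto simp: hole_edges_def adj_def)
  ultimately show False
    using assms(1-4) unfolding NC_vertex_def by metis
qed

text \<open>If both sides of a hole through \<open>u\<close> and \<open>a\<close> met connected sets containing \<open>b\<close>, then the two
  neighbours of \<open>a\<close> on that hole could be joined away from \<open>u\<close>, giving a hole that violates the
  NC property of \<open>u\<close>.\<close>

lemma NC_vertex_side:
  assumes wf: "wf_graph G" and NC: "NC_vertex G u" and "a \<noteq> u" "b \<noteq> u" "b \<noteq> a" "\<not> adj G a b"
    and a: "adj G u a \<or> (\<exists>T. is_hole G T \<and> u \<in> T \<and> a \<in> T)"
  obtains L t where "connected_set G L" "a \<in> L" "u \<notin> L" "L \<subseteq> verts G" "{y \<in> L. adj G u y} = {t}"
    "\<And>B. connected_set G B \<Longrightarrow> b \<in> B \<Longrightarrow> u \<notin> B \<Longrightarrow> B \<subseteq> verts G \<Longrightarrow> anticomplete G {a} B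
       \<Longrightarrow> anticomplete G L B"
proof (cases "adj G u a")
  case True
  have "{y \<in> {a}. adj G u y} = {a}" using True by auto
  then show ?thesis using that[of "{a}" a] True assms(3) wf_graph_adjD[OF wf True] by simp
next
  case False
  then obtain T where T: "is_hole G T" "u \<in> T" "a \<in> T" using a by blast
  obtain A A' s s' x x' where sides: "T = insert u (insert a (A \<union> A'))" "u \<notin> A \<union> A'" "a \<notin> A \<union> A'"
    "connected_set G A" "connected_set G A'" "anticomplete G A A'"
    "{z \<in> A. adj G u z} = {s}" "{z \<in> A'. adj G u z} = {s'}"
    "{z \<in> A. adj G a z} = {x}" "{z \<in> A'. adj G a z} = {x'}"
    by (rule hole_sides[OF T assms(3)[symmetric] False])
  have TV: "T \<subseteq> verts G" using T by (auto simp: is_hole_def)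
  have x: "x \<in> A" "adj G a x" and x': "x' \<in> A'" "adj G a x'" using sides by auto
  let ?good = "\<lambda>A. \<forall>B. connected_set G B \<and> b \<in> B \<and> u \<notin> B \<and> B \<subseteq> verts G \<and> anticomplete G {a} B
       \<longrightarrow> anticomplete G A B"
  have "?good A \<or> ?good A'"
  proof (rule ccontr)
    assume "\<not> ?thesis"
    then obtain B B' where B: "connected_set G B" "b \<in> B" "u \<notin> B" "B \<subseteq> verts G"
      "anticomplete G {a} B" "\<not> anticomplete G A B"
      and B': "connected_set G B'" "b \<in> B'" "u \<notin> B'" "B' \<subseteq> verts G"
      "anticomplete G {a} B'" "\<not> anticomplete G A' B'" by blast
    \<comment> \<open>Each side touches its own witness set and the two witness sets share
      \<open>b\<close>, so \<open>?W\<close> is connected. Inside it the only neighbours of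
      \<open>a\<close> are \<open>x\<close> and \<open>x'\<close>.\<close>
    let ?W = "(A \<union> B) \<union> (A' \<union> B')"
    have conn: "connected_set G ?W"
      using B B' connected_set_not_anticomplete_union[OF sides(4) B(1,6)]
        connected_set_not_anticomplete_union[OF sides(5) B'(1,6)]
      by (intro connected_set_union[of G "A \<union> B" "A' \<union> B'" b b]) auto
    have nxx: "x \<noteq> x'" "\<not> adj G x x'" using sides(6) x x' by (auto simp: anticomplete_def)
    have aW: "a \<notin> ?W" using sides B(5) B'(5) by (auto simp: anticomplete_def)
    have N: "adj G a w \<longleftrightarrow> w = x \<or> w = x'" if "w \<in> ?W" for w
      using that sides(9,10) B(5) B'(5) x x' by (auto simp: anticomplete_def)
    have V: "insert a ?W \<subseteq> verts G" using TV sides(1) B(4) B'(4) by auto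
    obtain H where H: "is_hole G H" "H \<subseteq> insert a ?W" "x \<in> H" "x' \<in> H" "a \<in> H"
      using hole_through[OF conn _ _ nxx aW N V] x x' by (metis UnI1 UnI2)
    have uH: "u \<notin> H" using H(2) sides(2) B(3) B'(3) assms(3) by auto
    show False
      using NC_vertexD[OF NC T(1,2) H(1) x(2) x'(2) nxx(1) T(3) _ _ H(5,3,4)] x x' sides(1) uH by blast
  qed
  then obtain A s x where A: "connected_set G A" "u \<notin> A" "a \<notin> A" "A \<subseteq> T" "{z \<in> A. adj G u z} = {s}"
    "x \<in> A" "adj G a x" and good: "?good A"
  proof (elim disjE)
    assume "?good A"
    then show thesis using that[of A s x] sides x by blast
  next
    assume "?good A'"
    then show thesis using that[of A' s' x'] sides x' by blast
  qed
  show ?thesis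
  proof (rule that[of "insert a A" s])
    show "connected_set G (insert a A)" using connected_set_insert A by metis
    show "{y \<in> insert a A. adj G u y} = {s}" using A(5) False by auto
    show "anticomplete G (insert a A) B"
      if "connected_set G B" "b \<in> B" "u \<notin> B" "B \<subseteq> verts G" "anticomplete G {a} B" for B
      using good that by (auto simp: anticomplete_def)
  qed (use A T TV assms(3) in auto)
qed

lemma adj_local_chordalize:
  "adj (local_chordalize G u) x y \<longleftrightarrow> adj G x y \<or>
     x \<noteq> y \<and> (x = u \<or> y = u) \<and> (\<exists>H. is_hole G H \<and> x \<in> H \<and> y \<in> H)"
  unfolding adj_def local_chordalize_def edges_def by (auto simp: doubleton_eq_iff)

lemma verts_local_chordalize [simp]: "verts (local_chordalize G u) = verts G"
  by (simp add: local_chordalize_def verts_def)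

lemma is_hole_cong:
  assumes "\<And>x y. x \<in> H \<Longrightarrow> y \<in> H \<Longrightarrow> adj G x y \<longleftrightarrow> adj G' x y"
    and "H \<subseteq> verts G \<longleftrightarrow> H \<subseteq> verts G'"
  shows "is_hole G H \<longleftrightarrow> is_hole G' H"
proof -
  have "(\<forall>i<length xs. \<forall>j<length xs. adj G (xs ! i) (xs ! j) \<longleftrightarrow>
            (j = Suc i mod length xs \<or> i = Suc j mod length xs)) \<longleftrightarrow>
     (\<forall>i<length xs. \<forall>j<length xs. adj G' (xs ! i) (xs ! j) \<longleftrightarrow>
            (j = Suc i mod length xs \<or> i = Suc j mod length xs))" if "set xs = H" for xs
    using assms(1) that by (metis nth_mem)
  then show ?thesis unfolding is_hole_def using assms(2) by (intro ex_cong1) blast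
qed

lemma wf_local_chordalize:
  assumes "wf_graph G" "u \<in> verts G"
  shows "wf_graph (local_chordalize G u)"
proof -
  have V: "H \<subseteq> verts G" if "is_hole G H" for H
    using that by (auto simp: is_hole_def)
  have "\<exists>x y. e = {x, y} \<and> x \<noteq> y \<and> x \<in> verts G \<and> y \<in> verts G"
    if e: "e \<in> edges (local_chordalize G u)" for e
  proof (cases "e \<in> edges G")
    case True
    then show ?thesis using assms(1) unfolding wf_graph_def by blast
  next
    case False
    then obtain w H where "e = {u, w}" "w \<noteq> u" "is_hole G H" "w \<in> H"
      using e by (auto simp: local_chordalize_def edges_def)
    then show ?thesis using V assms(2) by blast
  qed
  then show ?thesis using assms by (simp add: wf_graph_def)
qed

text \<open>Let \<open>a\<close> and \<open>b\<close> be the neighbours of \<open>u\<close> on a hole of the new graph and \<open>X\<close> the rest of it.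
  Extending \<open>a\<close> and \<open>b\<close> to anticomplete connected sets \<open>L\<close> and \<open>R\<close> reaching \<open>u\<close> yields a hole of the
  old graph through \<open>u\<close> and a vertex of \<open>X\<close>, which should have become a neighbour of \<open>u\<close>.\<close>

lemma no_hole_through_local_chordalize:
  assumes wf: "wf_graph G" and u: "u \<in> verts G" and NC: "NC_vertex G u"
    and H: "is_hole (local_chordalize G u) H"
  shows "u \<notin> H"
proof
  let ?F = "local_chordalize G u"
  assume "u \<in> H"
  then obtain xs where xs: "induced_path ?F xs" "length xs \<ge> 3" "u \<notin> set xs" "H = insert u (set xs)"
    and N: "\<And>i. i < length xs \<Longrightarrow> adj ?F u (xs ! i) \<longleftrightarrow> i = 0 \<or> Suc i = length xs"
    using holeE[OF H] by metis
  have HV: "H \<subseteq> verts G" using H by (auto simp: is_hole_def)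
  define n where "n = length xs"
  have n: "n \<ge> 3" using xs by (simp add: n_def)
  have "adj ?F x y \<longleftrightarrow> adj G x y" if "x \<in> set xs" "y \<in> set xs" for x y
    using that xs(3) by (auto simp: adj_local_chordalize)
  then have ip: "induced_path G xs" using xs(1) by (auto simp: induced_path_def)
  then have dx: "distinct xs" by (simp add: induced_path_def)
  have adj: "adj G (xs ! i) (xs ! j) \<longleftrightarrow> j = Suc i \<or> i = Suc j" if "i < n" "j < n" for i j
    using ip that by (auto simp: induced_path_def n_def)
  define a where "a = xs ! 0"
  define b where "b = xs ! (n - 1)"
  \<comment> \<open>The path without its two ends, that is, the part of the new hole not adjacent to
    \<open>u\<close>.\<close>
  define X where "X = set (take (n - 2) (drop 1 xs))"
  have ab: "a \<in> set xs" "b \<in> set xs" using n by (auto simp: a_def b_def n_def intro!: nth_mem)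
  have Xc: "connected_set G X"
    unfolding X_def by (intro induced_path_connected induced_path_take induced_path_drop ip)
  have Xi: "\<exists>i. 0 < i \<and> Suc i < n \<and> x = xs ! i" if x: "x \<in> X" for x
  proof -
    obtain i where "i < n - 2" "x = xs ! Suc i"
      using x by (auto simp: X_def set_conv_nth n_def)
    then show ?thesis by (intro exI[of _ "Suc i"]) auto
  qed
  have iX: "xs ! i \<in> X" if "0 < i" "Suc i < n" for i
  proof -
    have "xs ! i = take (n - 2) (drop 1 xs) ! (i - 1)" "i - 1 < length (take (n - 2) (drop 1 xs))"
      using that by (auto simp: n_def)
    then show ?thesis unfolding X_def by (metis nth_mem)
  qed
  have XV: "X \<subseteq> verts G"
    using HV xs(4) set_take_subset[of "n - 2" "drop 1 xs"] set_drop_subset[of 1 xs] unfolding X_def by blast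
  have uX: "u \<notin> X" using Xi xs(3) by (metis Suc_lessD n_def nth_mem)
  have Xnew: "\<not> adj ?F u x" if "x \<in> X" for x
    using Xi[OF that] N by (auto simp: n_def)
  \<comment> \<open>A vertex of \<open>X\<close> on an old hole through \<open>u\<close> would have
    been joined to \<open>u\<close>.\<close>
  have Xold: "\<not> adj G u x" "\<not> (\<exists>T. is_hole G T \<and> u \<in> T \<and> x \<in> T)" if "x \<in> X" for x
    using Xnew[OF that] that uX by (auto simp: adj_local_chordalize)
  have nab: "a \<noteq> b" "\<not> adj G a b" "a \<noteq> u" "b \<noteq> u"
  proof -
    have "0 < length xs" "n - 1 < length xs" "0 < n" "n - 1 < n" "n - 1 \<noteq> 0" "n - 1 \<noteq> Suc 0"
      using n by (auto simp: n_def)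
    then show "a \<noteq> b" "\<not> adj G a b" "a \<noteq> u" "b \<noteq> u"
      using adj[of 0 "n - 1"] ab xs(3) nth_eq_iff_index_eq[OF dx, of 0 "n - 1"]
      unfolding a_def b_def by auto
  qed
  have Fab: "adj ?F u a" "adj ?F u b" using N[of 0] N[of "n - 1"] n unfolding a_def b_def n_def by fastforce+
  then have hab: "adj G u a \<or> (\<exists>T. is_hole G T \<and> u \<in> T \<and> a \<in> T)"
    "adj G u b \<or> (\<exists>T. is_hole G T \<and> u \<in> T \<and> b \<in> T)"
    by (auto simp: adj_local_chordalize)
  have nba: "\<not> adj G b a" using nab(2) adj_sym by metis
  obtain L t where L: "connected_set G L" "a \<in> L" "u \<notin> L" "L \<subseteq> verts G" "{y \<in> L. adj G u y} = {t}"
    "\<And>B. connected_set G B \<Longrightarrow> b \<in> B \<Longrightarrow> u \<notin> B \<Longrightarrow> B \<subseteq> verts G \<Longrightarrow> anticomplete G {a} B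
       \<Longrightarrow> anticomplete G L B"
    using NC_vertex_side[OF wf NC nab(3,4) nab(1)[symmetric] nab(2) hab(1)] by blast
  obtain R s where R: "connected_set G R" "b \<in> R" "u \<notin> R" "R \<subseteq> verts G" "{y \<in> R. adj G u y} = {s}"
    "\<And>B. connected_set G B \<Longrightarrow> a \<in> B \<Longrightarrow> u \<notin> B \<Longrightarrow> B \<subseteq> verts G \<Longrightarrow> anticomplete G {b} B
       \<Longrightarrow> anticomplete G R B"
    using NC_vertex_side[OF wf NC nab(4,3) nab(1) nba hab(2)] by blast
  \<comment> \<open>The two extensions are separated in turn: first \<open>R\<close> from the single
    vertex \<open>a\<close>, then \<open>L\<close> from all of \<open>R\<close>.\<close>
  have "anticomplete G R {a}"
    using R(6)[of "{a}"] nab nba ab HV xs(4) by (auto simp: anticomplete_def)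
  then have LR: "anticomplete G L R"
    using L(6)[OF R(1-4)] anticomplete_sym by blast
  let ?W = "L \<union> X \<union> R"
  have e: "xs ! 1 \<in> X" "adj G a (xs ! 1)" "xs ! (n - 2) \<in> X" "adj G (xs ! (n - 2)) b"
    using n iX adj[of 0 1] adj[of "n - 2" "n - 1"] by (auto simp: a_def b_def)
  have conn: "connected_set G ?W"
    using L(1,2) R(1,2) Xc e
    by (intro connected_set_union[of G "L \<union> X" R "xs ! (n - 2)" b]
        connected_set_union[of G L X a "xs ! 1"]) auto
  have ts: "t \<in> L" "s \<in> R" using L(5) R(5) by auto
  have nts: "t \<noteq> s" "\<not> adj G t s" using LR ts by (auto simp: anticomplete_def)
  have uW: "u \<notin> ?W" using L R uX by blast
  have NW: "adj G u w \<longleftrightarrow> w = t \<or> w = s" if "w \<in> ?W" for w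
    using that L(5) R(5) Xold by auto
  have V: "insert u ?W \<subseteq> verts G" using u L R XV by blast
  obtain T where T: "is_hole G T" "T \<subseteq> insert u ?W" "t \<in> T" "s \<in> T" "u \<in> T"
    "connected_set G (T - {u})"
    using hole_through[OF conn _ _ nts uW NW V] ts by (metis UnI1 UnI2)
  \<comment> \<open>Avoiding \<open>X\<close>, the connected set \<open>T - {u}\<close> would have
    to pass from \<open>L\<close> to \<open>R\<close> directly.\<close>
  have "T \<inter> X = {}" using Xold(2) T by blast
  then have "T - {u} \<subseteq> L \<union> R" using T(2) by blast
  then show False
    using connected_set_not_separated[OF T(6) _ LR, of t s] T ts uW by blast
qed

text \<open>All added edges end in \<open>u\<close>, so holes avoiding \<open>u\<close> neither
  appear nor disappear; holes through \<open>u\<close> are excluded by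
  \<open>no_hole_through_local_chordalize\<close>.\<close>

lemma is_hole_local_chordalize:
  assumes "wf_graph G" "u \<in> verts G" "NC_vertex G u"
  shows "is_hole (local_chordalize G u) H \<longleftrightarrow> is_hole G H \<and> u \<notin> H"
proof -
  have "is_hole (local_chordalize G u) H \<longleftrightarrow> is_hole G H" if "u \<notin> H"
    by (rule is_hole_cong) (use that in \<open>auto simp: adj_local_chordalize\<close>)
  then show ?thesis using no_hole_through_local_chordalize[OF assms] by blast
qed

section \<open>Successive local chordalization by the vertices of a set\<close>

lemma hole_edges_local_chordalize:
  "u \<notin> H \<Longrightarrow> hole_edges (local_chordalize G u) H = hole_edges G H"
  by (auto simp: hole_edges_def local_chordalize_def edges_def)

text \<open>Both holes of a violating pair in the new graph avoid \<open>u\<close>, so they are old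
  holes with unchanged edges and violate the property already in \<open>G\<close>.\<close>

lemma NC_vertex_local_chordalize:
  assumes "wf_graph G" "u \<in> verts G" "NC_vertex G u" "NC_vertex G v"
  shows "NC_vertex (local_chordalize G u) v"
  unfolding NC_vertex_def
proof (rule notI, elim exE conjE)
  let ?F = "local_chordalize G u"
  fix H H' e1 e2
  assume *: "is_hole ?F H" "v \<in> H" "is_hole ?F H'" "v \<notin> H'" "e1 \<noteq> e2" "e1 \<inter> e2 \<noteq> {}"
    "e1 \<in> hole_edges ?F H" "e2 \<in> hole_edges ?F H" "e1 \<in> hole_edges ?F H'" "e2 \<in> hole_edges ?F H'"
  then have "is_hole G H" "u \<notin> H" "is_hole G H'" "u \<notin> H'"
    using is_hole_local_chordalize[OF assms(1-3)] by auto
  with * show False using assms(4) unfolding NC_vertex_def by (metis hole_edges_local_chordalize)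
qed

text \<open>No hole contains two vertices of \<open>xs\<close>, so chordalizing by one vertex leaves
  the holes through the later ones intact. Hence all added edges can be read off the holes of the
  original \<open>G\<close>, and the order of \<open>xs\<close> does not affect adjacency.\<close>

lemma foldl_local_chordalize:
  assumes "wf_graph G" "distinct xs" "set xs \<subseteq> verts G" "\<forall>u\<in>set xs. NC_vertex G u"
    and "\<forall>H. is_hole G H \<longrightarrow> (\<forall>x\<in>H \<inter> set xs. \<forall>y\<in>H \<inter> set xs. x = y)"
  shows "wf_graph (foldl local_chordalize G xs) \<and> verts (foldl local_chordalize G xs) = verts G \<and>
    (\<forall>x y. adj (foldl local_chordalize G xs) x y \<longleftrightarrow> adj G x y \<or>
       x \<noteq> y \<and> (x \<in> set xs \<or> y \<in> set xs) \<and> (\<exists>H. is_hole G H \<and> x \<in> H \<and> y \<in> H))"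
  using assms
proof (induction xs arbitrary: G)
  case (Cons u xs)
  let ?F = "local_chordalize G u"
  have u: "u \<in> verts G" "NC_vertex G u" using Cons.prems by auto
  note hole = is_hole_local_chordalize[OF Cons.prems(1) u]
  have IH: "wf_graph (foldl local_chordalize ?F xs) \<and> verts (foldl local_chordalize ?F xs) = verts ?F \<and>
    (\<forall>x y. adj (foldl local_chordalize ?F xs) x y \<longleftrightarrow> adj ?F x y \<or>
       x \<noteq> y \<and> (x \<in> set xs \<or> y \<in> set xs) \<and> (\<exists>H. is_hole ?F H \<and> x \<in> H \<and> y \<in> H))"
  proof (rule Cons.IH[of ?F])
    show "wf_graph ?F" by (rule wf_local_chordalize[OF Cons.prems(1) u(1)])
    show "distinct xs" "set xs \<subseteq> verts ?F" using Cons.prems(2,3) by auto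
    show "\<forall>v\<in>set xs. NC_vertex ?F v"
      using Cons.prems(4) NC_vertex_local_chordalize[OF Cons.prems(1) u] by simp
    show "\<forall>H. is_hole ?F H \<longrightarrow> (\<forall>x\<in>H \<inter> set xs. \<forall>y\<in>H \<inter> set xs. x = y)"
      unfolding hole using Cons.prems(5) by (simp only: set_simps) blast
  qed
  have one: "u \<notin> H" if "is_hole G H" "x \<in> H" "x \<in> set xs" for H x
    using Cons.prems(2,5) that by auto
  have "adj (foldl local_chordalize ?F xs) x y \<longleftrightarrow> adj G x y \<or>
       x \<noteq> y \<and> (x \<in> set (u # xs) \<or> y \<in> set (u # xs)) \<and> (\<exists>H. is_hole G H \<and> x \<in> H \<and> y \<in> H)" for x y
    using IH unfolding hole adj_local_chordalize set_simps insert_iff using one by blast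
  then show ?case using IH by simp
qed simp

lemma hole_inter_NC_set:
  assumes "NC_set G C" "is_hole G H" "x \<in> H" "x \<in> C" "y \<in> H" "y \<in> C"
  shows "x = y"
proof -
  \<comment> \<open>Needed because an infinite set has cardinality 0 and would satisfy the bound
    trivially.\<close>
  have "finite H" using assms(2) by (auto simp: is_hole_def)
  moreover have "card (H \<inter> C) \<le> Suc 0" using assms(1,2) by (auto simp: NC_set_def)
  ultimately show ?thesis using assms by (auto simp: card_le_Suc0_iff_eq)
qed

lemma hatG_properties:
  assumes "wf_graph G" "C \<subseteq> verts G" "NC_set G C"
  shows wf_hatG: "wf_graph (hatG G C)" and verts_hatG: "verts (hatG G C) = verts G"
    and adj_hatG: "adj (hatG G C) x y \<longleftrightarrow> adj G x y \<or>
       x \<noteq> y \<and> (x \<in> C \<or> y \<in> C) \<and> (\<exists>H. is_hole G H \<and> x \<in> H \<and> y \<in> H)"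
proof -
  \<comment> \<open>The list chosen inside \<open>hatG\<close>; it exists because \<open>C\<close>
    is finite.\<close>
  define xs where "xs = (SOME xs. distinct xs \<and> set xs = C)"
  have "finite C" using assms(1,2) by (auto simp: wf_graph_def intro: finite_subset)
  then have xs: "distinct xs \<and> set xs = C"
    unfolding xs_def by (metis (mono_tags, lifting) finite_distinct_list someI_ex)
  have h: "hatG G C = foldl local_chordalize G xs" by (simp add: hatG_def xs_def)
  have "\<forall>H. is_hole G H \<longrightarrow> (\<forall>x\<in>H \<inter> set xs. \<forall>y\<in>H \<inter> set xs. x = y)"
    using hole_inter_NC_set[OF assms(3)] xs by blast
  moreover have "\<forall>u\<in>set xs. NC_vertex G u" using assms(3) xs by (simp add: NC_set_def)
  ultimately have "wf_graph (hatG G C) \<and> verts (hatG G C) = verts G \<and>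
    (\<forall>x y. adj (hatG G C) x y \<longleftrightarrow> adj G x y \<or>
       x \<noteq> y \<and> (x \<in> C \<or> y \<in> C) \<and> (\<exists>H. is_hole G H \<and> x \<in> H \<and> y \<in> H))"
    using foldl_local_chordalize[of G xs] assms xs unfolding h by blast
  then show "wf_graph (hatG G C)" "verts (hatG G C) = verts G"
    "adj (hatG G C) x y \<longleftrightarrow> adj G x y \<or>
       x \<noteq> y \<and> (x \<in> C \<or> y \<in> C) \<and> (\<exists>H. is_hole G H \<and> x \<in> H \<and> y \<in> H)" by blast+
qed

subsection \<open>Cliques of the chordalized graph\<close>

text \<open>From \<open>w\<close>, the set \<open>L\<close> reaches \<open>u\<close> without
  touching \<open>v\<close>, and \<open>L'\<close> reaches \<open>v\<close> without touching
  \<open>u\<close>. A path through both sets together with the edge \<open>uv\<close> closes to a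
  hole containing two vertices of \<open>C\<close>.\<close>

lemma no_common_new_neighbour:
  assumes wf: "wf_graph G" and C: "C \<subseteq> verts G" "NC_set G C"
    and uv: "u \<in> C" "v \<in> C" "adj G u v"
    and w: "w \<noteq> u" "w \<noteq> v" "\<not> adj G u w" "\<not> adj G v w"
    and T: "is_hole G T" "u \<in> T" "w \<in> T" and T': "is_hole G T'" "v \<in> T'" "w \<in> T'"
  shows False
proof -
  have NC: "NC_vertex G u" "NC_vertex G v" using C uv by (auto simp: NC_set_def)
  have ne: "u \<noteq> v" using uv by auto
  have V: "u \<in> verts G" "v \<in> verts G" using C uv by auto
  have nw: "\<not> adj G w u" "\<not> adj G w v" using w by (auto simp: adj_commute)
  have ex: "\<exists>T. is_hole G T \<and> u \<in> T \<and> w \<in> T" "\<exists>T. is_hole G T \<and> v \<in> T \<and> w \<in> T"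
    using T T' by blast+
  obtain L t where L: "connected_set G L" "w \<in> L" "u \<notin> L" "L \<subseteq> verts G" "{y \<in> L. adj G u y} = {t}"
    "\<And>B. connected_set G B \<Longrightarrow> v \<in> B \<Longrightarrow> u \<notin> B \<Longrightarrow> B \<subseteq> verts G \<Longrightarrow> anticomplete G {w} B
       \<Longrightarrow> anticomplete G L B"
    using NC_vertex_side[OF wf NC(1) w(1) ne[symmetric] w(2)[symmetric] nw(2) disjI2[OF ex(1)]] by blast
  obtain L' t' where L': "connected_set G L'" "w \<in> L'" "v \<notin> L'" "L' \<subseteq> verts G"
    "{y \<in> L'. adj G v y} = {t'}"
    "\<And>B. connected_set G B \<Longrightarrow> u \<in> B \<Longrightarrow> v \<notin> B \<Longrightarrow> B \<subseteq> verts G \<Longrightarrow> anticomplete G {w} B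
       \<Longrightarrow> anticomplete G L' B"
    using NC_vertex_side[OF wf NC(2) w(2) ne w(1)[symmetric] nw(1) disjI2[OF ex(2)]] by blast
  \<comment> \<open>The separation property of \<open>L\<close> is applied to the trivial connected
    set \<open>{v}\<close>.\<close>
  have Lv: "anticomplete G L {v}"
    using L(6)[of "{v}"] ne w nw V by (auto simp: anticomplete_def)
  have Lu: "anticomplete G L' {u}"
    using L'(6)[of "{u}"] ne w nw V by (auto simp: anticomplete_def)
  have t: "t \<in> L" "adj G u t" "t' \<in> L'" "adj G v t'" using L(5) L'(5) by auto
  let ?W = "L \<union> insert v L'"
  have conn: "connected_set G ?W"
    using connected_set_union[of G L "insert v L'" w w] connected_set_insert[OF L'(1) t(3,4)] L L' by simp
  have tv: "t \<noteq> v" "\<not> adj G t v" using Lv t by (auto simp: anticomplete_def)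
  have uW: "u \<notin> ?W" using L Lu ne by (auto simp: anticomplete_def)
  have N: "adj G u y \<longleftrightarrow> y = t \<or> y = v" if "y \<in> ?W" for y
  proof -
    have "y \<in> L' \<Longrightarrow> \<not> adj G u y" using Lu adj_sym[of G u y] by (auto simp: anticomplete_def)
    then show ?thesis using that t uv L(5) by blast
  qed
  have WV: "insert u ?W \<subseteq> verts G" using V L L' by auto
  obtain H where "is_hole G H" "u \<in> H" "v \<in> H"
    using hole_through[OF conn _ _ tv uW N WV] t by (metis UnI1 UnI2 insertI1)
  then show False using hole_inter_NC_set[OF C(2)] uv ne by blast
qed

lemma four_hole:
  assumes "wf_graph G" "adj G a b" "adj G b c" "adj G c d" "adj G d a" "a \<noteq> c" "b \<noteq> d"
    "\<not> adj G a c" "\<not> adj G b d"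
  shows "\<exists>H. is_hole G H \<and> {a, b, c, d} \<subseteq> H"
proof -
  have s: "adj G b a" "adj G c b" "adj G d c" "adj G a d" "\<not> adj G c a" "\<not> adj G d b"
    using assms by (auto simp: adj_commute)
  have conn: "connected_set G {b, c, d}"
    using connected_set_insert[of G "{c, d}" c b] connected_set_insert[of G "{d}" d c] assms by simp
  have a: "a \<notin> {b, c, d}" using assms by auto
  have N: "adj G a w \<longleftrightarrow> w = b \<or> w = d" if "w \<in> {b, c, d}" for w
    using that assms s by auto
  have V: "insert a {b, c, d} \<subseteq> verts G" using wf_graph_adjD[OF assms(1)] assms(2-5) by blast
  obtain H where H: "is_hole G H" "H \<subseteq> insert a {b, c, d}" "b \<in> H" "d \<in> H" "a \<in> H"
    "connected_set G (H - {a})"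
    by (rule hole_through[OF conn _ _ assms(7,9) a N V]) auto
  \<comment> \<open>The connected set \<open>H - {a}\<close> contains the nonadjacent
    \<open>b\<close> and \<open>d\<close>, and only \<open>c\<close> can link them.\<close>
  have "c \<in> H"
  proof (rule ccontr)
    assume "c \<notin> H"
    then have "H - {a} \<subseteq> {b} \<union> {d}" using H(2) by auto
    moreover have "anticomplete G {b} {d}" using assms by (auto simp: anticomplete_def)
    ultimately show False
      using connected_set_not_separated[OF H(6), of "{b}" "{d}" b d] H assms s by auto
  qed
  then show ?thesis using H by blast
qed

text \<open>A non-edge of \<open>G\<close> inside \<open>K\<close> joins a vertex of
  \<open>C\<close> to one outside \<open>C\<close>. If it is not enough to remove one such
  \<open>u\<close>, there is a second \<open>v\<close> in \<open>C\<close>; their non-neighbours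
  \<open>w\<close> and \<open>z\<close> differ by \<open>no_common_new_neighbour\<close>, and
  \<open>u\<close>, \<open>z\<close>, \<open>w\<close>, \<open>v\<close> form an induced 4-cycle
  meeting \<open>C\<close> twice.\<close>

lemma hatG_clique:
  assumes wf: "wf_graph G" and C: "C \<subseteq> verts G" "NC_set G C"
    and K: "is_clique (hatG G C) K"
  shows "\<exists>u. is_clique G (K - {u})"
proof (cases "is_clique G K")
  case True
  \<comment> \<open>Removing any vertex at all keeps a clique.\<close>
  then have "is_clique G (K - {undefined})" by (auto simp: is_clique_def)
  then show ?thesis by blast
next
  case False
  note adj = adj_hatG[OF wf C]
  have KV: "K \<subseteq> verts G" using K verts_hatG[OF wf C] by (simp add: is_clique_def)
  have Kadj: "adj (hatG G C) x y" if "x \<in> K" "y \<in> K" "x \<noteq> y" for x y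
    using K that by (auto simp: is_clique_def)
  have new: "\<exists>T. is_hole G T \<and> x \<in> T \<and> y \<in> T" if "x \<in> K" "y \<in> K" "x \<noteq> y" "\<not> adj G x y" for x y
    using Kadj[OF that(1-3)] that(4) unfolding adj by blast
  have CC: "adj G x y" if "x \<in> K" "y \<in> K" "x \<noteq> y" "x \<in> C \<longleftrightarrow> y \<in> C" for x y
    using Kadj[OF that(1-3)] that hole_inter_NC_set[OF C(2)] unfolding adj by blast
  have nonadj: "\<exists>u w. u \<in> X \<and> w \<in> X \<and> u \<in> C \<and> w \<notin> C \<and> \<not> adj G u w"
    if X: "X \<subseteq> K" "\<not> is_clique G X" for X
  proof -
    obtain x y where xy: "x \<in> X" "y \<in> X" "x \<noteq> y" "\<not> adj G x y"
      using X KV unfolding is_clique_def by blast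
    then have "x \<in> C \<longleftrightarrow> y \<notin> C" using CC[of x y] X by blast
    then show ?thesis using xy adj_sym[of G y x] by blast
  qed
  obtain u w where uw: "u \<in> K" "w \<in> K" "u \<in> C" "w \<notin> C" "\<not> adj G u w"
    using nonadj[OF order_refl False] by blast
  have "is_clique G (K - {u})"
  proof (rule ccontr)
    assume "\<not> ?thesis"
    then obtain v z where vz: "v \<in> K - {u}" "z \<in> K - {u}" "v \<in> C" "z \<notin> C" "\<not> adj G v z"
      using nonadj[of "K - {u}"] by blast
    have uv: "adj G u v" using CC[of u v] uw vz by blast
    have ne: "w \<noteq> u" "w \<noteq> v" "z \<noteq> u" "z \<noteq> v" using uw vz by auto
    have common: False if x: "x \<in> K" "x \<noteq> u" "x \<noteq> v" "\<not> adj G u x" "\<not> adj G v x" for x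
    proof -
      obtain T where "is_hole G T" "u \<in> T" "x \<in> T" using new[of u x] x uw by blast
      moreover obtain T' where "is_hole G T'" "v \<in> T'" "x \<in> T'" using new[of v x] x vz by blast
      ultimately show False using no_common_new_neighbour[OF wf C uw(3) vz(3) uv x(2-5)] by blast
    qed
    have vw: "adj G v w" using common[of w] uw ne by blast
    have uz: "adj G u z" using common[of z] vz ne by blast
    have wz: "w \<noteq> z" using vw vz by auto
    have "adj G z w" using CC[of z w] uw vz wz by blast
    then obtain H where "is_hole G H" "{u, z, w, v} \<subseteq> H"
      using four_hole[OF wf uz _ adj_sym[OF vw] adj_sym[OF uv]] ne uw(5) vz(5) adj_sym[of G z v] by metis
    then show False using hole_inter_NC_set[OF C(2), of H u v] uw vz by auto
  qed
  then show ?thesis by blast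
qed

subsection \<open>DP-colouring chordal graphs\<close>

text \<open>Relative to a vertex set instead of an induced subgraph, so that inductions shrink
  \<open>U\<close> and keep the graph fixed.\<close>

definition simplicial :: "'a graph \<Rightarrow> 'a set \<Rightarrow> 'a \<Rightarrow> bool" where
  "simplicial G U s \<longleftrightarrow> s \<in> U \<and>
     (\<forall>x\<in>U. \<forall>y\<in>U. adj G s x \<and> adj G s y \<and> x \<noteq> y \<longrightarrow> adj G x y)"

text \<open>A strengthening of Dirac's theorem, in which the simplicial vertex avoids a given
  \<open>v\<close> and its neighbours. Here \<open>D\<close> is the component of \<open>p\<close>
  among the non-neighbours of \<open>v\<close>, and \<open>S\<close> is its boundary, a clique by
  chordality. Induction on \<open>D \<union> S\<close>, which misses \<open>v\<close>, can be
  steered to a simplicial vertex in \<open>D\<close>.\<close>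

lemma simplicial_non_neighbour:
  assumes "finite U" "chordal G" "U \<subseteq> verts G" "v \<in> U" "p \<in> U" "p \<noteq> v" "\<not> adj G v p"
  shows "\<exists>s. simplicial G U s \<and> s \<noteq> v \<and> \<not> adj G v s"
  using assms
proof (induction "card U" arbitrary: U v p rule: less_induct)
  case less
  let ?R = "\<lambda>x y. x \<in> {x \<in> U. x \<noteq> v \<and> \<not> adj G v x} \<and> y \<in> {x \<in> U. x \<noteq> v \<and> \<not> adj G v x} \<and> adj G x y"
  define D where "D = {d. ?R\<^sup>*\<^sup>* p d}"
  define S where "S = {x \<in> U. adj G v x \<and> (\<exists>d\<in>D. adj G x d)}"
  have pD: "p \<in> D" by (simp add: D_def)
  have DU: "d \<in> U \<and> d \<noteq> v \<and> \<not> adj G v d" if "d \<in> D" for d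
  proof -
    have "?R\<^sup>*\<^sup>* p d" using that by (simp add: D_def)
    then show ?thesis by cases (use less.prems in auto)
  qed
  have Dclosed: "y \<in> D \<union> S" if "d \<in> D" "y \<in> U" "adj G d y" for d y
  proof (cases "adj G v y")
    case True
    then show ?thesis using that by (auto simp: S_def adj_commute)
  next
    case False
    have "y \<noteq> v" using DU[OF that(1)] that(3) adj_sym by metis
    then have "?R d y" using False DU that by auto
    moreover have "?R\<^sup>*\<^sup>* p d" using that by (simp add: D_def)
    ultimately show ?thesis by (simp add: D_def rtranclp.rtrancl_into_rtrancl)
  qed
  have pd: "(\<lambda>x y. x \<in> D \<and> y \<in> D \<and> adj G x y)\<^sup>*\<^sup>* p d" if "d \<in> D" for d
  proof -
    have "?R\<^sup>*\<^sup>* p d" using that by (simp add: D_def)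
    then show ?thesis
    proof (induction rule: rtranclp_induct)
      case (step y z)
      have "y \<in> D" using step by (simp add: D_def)
      moreover have "z \<in> D"
        using rtranclp.rtrancl_into_rtrancl[OF step(1,2)] unfolding D_def by (rule CollectI)
      ultimately show ?case using step by (simp add: rtranclp.rtrancl_into_rtrancl)
    qed simp
  qed
  have sym: "symp (\<lambda>x y. x \<in> D \<and> y \<in> D \<and> adj G x y)" by (auto simp: symp_def adj_commute)
  have Dc: "connected_set G D"
    unfolding connected_set_def
  proof (intro ballI)
    fix x y assume "x \<in> D" "y \<in> D"
    then show "(\<lambda>x y. x \<in> D \<and> y \<in> D \<and> adj G x y)\<^sup>*\<^sup>* x y"
      using rtranclp_trans[OF sympD[OF symp_rtranclp[OF sym] pd] pd] by blast
  qed
  have SU: "S \<subseteq> U" by (auto simp: S_def)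
  \<comment> \<open>Otherwise a path from \<open>x\<close> to \<open>y\<close> through
    \<open>D\<close> is closed by \<open>v\<close> to a hole.\<close>
  have Sclique: "adj G x y" if xy: "x \<in> S" "y \<in> S" "x \<noteq> y" for x y
  proof (rule ccontr)
    assume n: "\<not> adj G x y"
    obtain d d' where d: "d \<in> D" "adj G x d" "d' \<in> D" "adj G y d'" using xy by (auto simp: S_def)
    let ?W = "insert y (insert x D)"
    have conn: "connected_set G ?W"
      using connected_set_insert[OF connected_set_insert[OF Dc d(1,2)], of d' y] d by simp
    have vW: "v \<notin> ?W" using xy DU by (auto simp: S_def)
    have N: "adj G v w \<longleftrightarrow> w = x \<or> w = y" if "w \<in> ?W" for w
      using that xy DU by (auto simp: S_def)
    have V: "insert v ?W \<subseteq> verts G" using less.prems DU SU xy by blast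
    obtain H where "is_hole G H"
      by (rule hole_through[OF conn _ _ xy(3) n vW N V]) auto
    then show False using less.prems(2) by (auto simp: chordal_def)
  qed
  let ?U = "D \<union> S"
  have UU: "?U \<subseteq> U" using DU SU by blast
  have "v \<notin> ?U" using DU by (auto simp: S_def)
  then have lt: "card ?U < card U"
    using UU less.prems(1,4) by (intro psubset_card_mono) auto
  have fin: "finite ?U" "?U \<subseteq> verts G" using UU less.prems finite_subset by blast+
  \<comment> \<open>All neighbours in \<open>U\<close> of a vertex of \<open>D\<close> lie in
    \<open>D \<union> S\<close>.\<close>
  have lift: "simplicial G U s \<and> s \<noteq> v \<and> \<not> adj G v s" if "simplicial G ?U s" "s \<in> D" for s
    using that DU[OF that(2)] Dclosed[OF that(2)] by (auto simp: simplicial_def)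
  show ?case
  proof (cases "\<exists>x\<in>S. \<exists>q\<in>?U. q \<noteq> x \<and> \<not> adj G x q")
    case True
    then obtain x q where x: "x \<in> S" "q \<in> ?U" "q \<noteq> x" "\<not> adj G x q" by blast
    then obtain s where s: "simplicial G ?U s" "s \<noteq> x" "\<not> adj G x s"
      using less.hyps[OF lt fin(1) less.prems(2) fin(2), of x q] by blast
    \<comment> \<open>The vertex \<open>s\<close> is not adjacent to \<open>x\<close>, whereas
      \<open>S\<close> is a clique containing \<open>x\<close>.\<close>
    then have "s \<in> D" using Sclique[of x s] x by (auto simp: simplicial_def)
    then show ?thesis using lift s by blast
  next
    case False
    then have Sfull: "adj G x q" if "x \<in> S" "q \<in> ?U" "q \<noteq> x" for x q using that by blast
    show ?thesis
    proof (cases "\<exists>x\<in>D. \<exists>q\<in>?U. q \<noteq> x \<and> \<not> adj G x q")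
      case True
      then obtain x q where x: "x \<in> D" "q \<in> ?U" "q \<noteq> x" "\<not> adj G x q" by blast
      then obtain s where s: "simplicial G ?U s" "s \<noteq> x" "\<not> adj G x s"
        using less.hyps[OF lt fin(1) less.prems(2) fin(2), of x q] by blast
      have "s \<in> D"
      proof (rule ccontr)
        assume "s \<notin> D"
        then have "s \<in> S" using s by (auto simp: simplicial_def)
        then have "adj G s x" using Sfull[of s x] x(1) s(2) by simp
        then show False using s adj_sym by metis
      qed
      then show ?thesis using lift s by blast
    next
      case False
      \<comment> \<open>In the last case \<open>D \<union> S\<close> is a clique, so
        \<open>p\<close> itself is simplicial.\<close>
      then have "adj G x q" if "x \<in> ?U" "q \<in> ?U" "q \<noteq> x" for x q using Sfull that by blast
      then have "simplicial G ?U p" using pD by (auto simp: simplicial_def)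
      then show ?thesis using lift pD by blast
    qed
  qed
qed

lemma simplicial_exists:
  assumes "finite U" "chordal G" "U \<subseteq> verts G" "U \<noteq> {}"
  shows "\<exists>s. simplicial G U s"
proof (cases "\<exists>v\<in>U. \<exists>p\<in>U. p \<noteq> v \<and> \<not> adj G v p")
  case True
  then show ?thesis using simplicial_non_neighbour[OF assms(1-3)] by blast
next
  case False
  then have "adj G x y" if "x \<in> U" "y \<in> U" "y \<noteq> x" for x y using that by blast
  moreover obtain s where "s \<in> U" using assms(4) by blast
  ultimately have "simplicial G U s" by (auto simp: simplicial_def)
  then show ?thesis by blast
qed

text \<open>A simplicial vertex is coloured last. It forms a clique with its neighbours, so it has
  fewer than \<open>k\<close> of them, and each forbids at most one colour by the matching
  condition.\<close>

lemma chordal_dp_colorable: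
  assumes wf: "wf_graph G" and ch: "chordal G" and k: "\<And>K. is_clique G K \<Longrightarrow> card K \<le> k"
  shows "dp_colorable G k"
  unfolding dp_colorable_def
proof (intro allI impI)
  fix M assume M: "dp_cover G k M"
  have finV: "finite (verts G)" using wf by (simp add: wf_graph_def)
  have "\<exists>f. (\<forall>v\<in>U. f v < k) \<and> (\<forall>x\<in>U. \<forall>y\<in>U. adj G x y \<longrightarrow> \<not> M x y (f x) (f y))"
    if "U \<subseteq> verts G" for U
    using that
  proof (induction "card U" arbitrary: U rule: less_induct)
    case less
    have fin: "finite U" using less.prems finV finite_subset by blast
    show ?case
    proof (cases "U = {}")
      case False
      then obtain s where s: "simplicial G U s" using simplicial_exists[OF fin ch less.prems] by blast
      then have sU: "s \<in> U" by (simp add: simplicial_def)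
      obtain f where f: "\<forall>v\<in>U - {s}. f v < k"
        "\<forall>x\<in>U - {s}. \<forall>y\<in>U - {s}. adj G x y \<longrightarrow> \<not> M x y (f x) (f y)"
        using less.hyps[of "U - {s}"] less.prems card_Diff1_less[OF fin sU] by blast
      define N where "N = {y \<in> U. adj G s y}"
      have finN: "finite N" using fin by (simp add: N_def)
      have "is_clique G (insert s N)"
        using s less.prems unfolding is_clique_def simplicial_def N_def by (auto simp: adj_commute)
      then have "card (insert s N) \<le> k" by (rule k)
      then have cN: "card N < k" using finN by (simp add: N_def)
      \<comment> \<open>The colours of \<open>s\<close> that are forbidden by its coloured
        neighbours.\<close>
      define F where "F = (\<Union>y\<in>N. {c. c < k \<and> M s y c (f y)})"
      have "card {c. c < k \<and> M s y c (f y)} \<le> 1" if y: "y \<in> N" for y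
      proof -
        have "f y < k" "adj G y s" using f(1) y by (auto simp: N_def adj_commute)
        then have "c = c'" if "c < k" "M s y c (f y)" "c' < k" "M s y c' (f y)" for c c'
          using M that unfolding dp_cover_def by metis
        then show ?thesis by (auto simp: card_le_Suc0_iff_eq)
      qed
      then have "card F \<le> (\<Sum>y\<in>N. 1)"
        unfolding F_def by (intro order.trans[OF card_UN_le[OF finN]] sum_mono)
      then have "card F < card {..<k}" using cN by simp
      moreover have "F \<subseteq> {..<k}" by (auto simp: F_def)
      ultimately have "F \<subset> {..<k}" by blast
      then obtain c where c: "c < k" "c \<notin> F" by blast
      have ok: "\<not> M s y c (f y)" if "y \<in> U" "adj G s y" for y
        using c that by (auto simp: F_def N_def)
      have symM: "M x y i j \<longleftrightarrow> M y x j i" for x y i j using M unfolding dp_cover_def by blast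
      show ?thesis
      proof (intro exI[of _ "f(s := c)"] conjI ballI impI)
        fix v assume "v \<in> U" then show "(f(s := c)) v < k" using f(1) c by auto
      next
        fix x y assume xy: "x \<in> U" "y \<in> U" "adj G x y"
        show "\<not> M x y ((f(s := c)) x) ((f(s := c)) y)"
        proof (cases "x = s")
          case True
          then show ?thesis using ok[of y] xy by auto
        next
          case x: False
          show ?thesis
          proof (cases "y = s")
            case True
            then show ?thesis using ok[of x] xy x symM[of x s] adj_sym by (metis fun_upd_apply)
          next
            case False
            then show ?thesis using f(2) x xy by auto
          qed
        qed
      qed
    qed simp
  qed
  then obtain f where "\<forall>v\<in>verts G. f v < k"
    "\<forall>x\<in>verts G. \<forall>y\<in>verts G. adj G x y \<longrightarrow> \<not> M x y (f x) (f y)" by blast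
  then show "\<exists>f. (\<forall>v\<in>verts G. f v < k) \<and> (\<forall>u v. adj G u v \<longrightarrow> \<not> M u v (f u) (f v))"
    using wf_graph_adjD[OF wf] by blast
qed

lemma dp_colorable_subgraph:
  assumes "dp_colorable F k" "verts G \<subseteq> verts F" "\<And>x y. adj G x y \<Longrightarrow> adj F x y"
  shows "dp_colorable G k"
  unfolding dp_colorable_def
proof (intro allI impI)
  fix M assume M: "dp_cover G k M"
  \<comment> \<open>Edges of \<open>F\<close> missing in \<open>G\<close> receive the empty
    matching.\<close>
  let ?M = "\<lambda>u v i j. M u v i j \<and> adj G u v"
  have "M x y i j \<longleftrightarrow> M y x j i" for x y i j using M unfolding dp_cover_def by blast
  moreover have "j = j'" if "adj G x y" "i < k" "j < k" "j' < k" "M x y i j" "M x y i j'" for x y i j j'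
    using M that unfolding dp_cover_def by blast
  ultimately have "dp_cover F k ?M"
    unfolding dp_cover_def by (auto simp: adj_commute)
  then obtain f where "\<forall>v\<in>verts F. f v < k" "\<forall>u v. adj F u v \<longrightarrow> \<not> ?M u v (f u) (f v)"
    using assms(1) unfolding dp_colorable_def by blast
  then show "\<exists>f. (\<forall>v\<in>verts G. f v < k) \<and> (\<forall>u v. adj G u v \<longrightarrow> \<not> M u v (f u) (f v))"
    using assms(2,3) by blast
qed

subsection \<open>Rooted clique models\<close>

text \<open>A complete minor whose branch sets contain prescribed roots. The roots allow vertices
  adjacent to all of \<open>A\<close> to be added later; the set \<open>V\<close> confines the
  branch sets, so that vertices outside \<open>V\<close> stay free.\<close>

definition rooted_clique_model :: "'a graph \<Rightarrow> 'a set \<Rightarrow> 'a set \<Rightarrow> bool" where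
  "rooted_clique_model G V A \<longleftrightarrow> (\<exists>B.
     (\<forall>x\<in>A. x \<in> B x \<and> B x \<subseteq> V \<and> connected_set G (B x)) \<and>
     (\<forall>x\<in>A. \<forall>y\<in>A. x \<noteq> y \<longrightarrow> B x \<inter> B y = {} \<and> (\<exists>p\<in>B x. \<exists>q\<in>B y. adj G p q)))"

lemma connected_set_mono_graph:
  assumes "connected_set F S" "\<And>x y. adj F x y \<Longrightarrow> adj G x y"
  shows "connected_set G S"
  unfolding connected_set_def
proof (intro ballI)
  fix u v assume "u \<in> S" "v \<in> S"
  then have "(\<lambda>x y. x \<in> S \<and> y \<in> S \<and> adj F x y)\<^sup>*\<^sup>* u v" using assms(1) by (auto simp: connected_set_def)
  then show "(\<lambda>x y. x \<in> S \<and> y \<in> S \<and> adj G x y)\<^sup>*\<^sup>* u v"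
    by (rule rtranclp_mono[THEN predicate2D, rotated]) (use assms(2) in auto)
qed

lemma rooted_clique_model_mono_graph:
  assumes "rooted_clique_model F V A" "\<And>x y. adj F x y \<Longrightarrow> adj G x y"
  shows "rooted_clique_model G V A"
proof -
  obtain B where B: "\<forall>x\<in>A. x \<in> B x \<and> B x \<subseteq> V \<and> connected_set F (B x)"
    "\<forall>x\<in>A. \<forall>y\<in>A. x \<noteq> y \<longrightarrow> B x \<inter> B y = {} \<and> (\<exists>p\<in>B x. \<exists>q\<in>B y. adj F p q)"
    using assms(1) unfolding rooted_clique_model_def by blast
  have "\<forall>x\<in>A. x \<in> B x \<and> B x \<subseteq> V \<and> connected_set G (B x)"
    using B(1) connected_set_mono_graph[OF _ assms(2)] by blast
  moreover have "\<forall>x\<in>A. \<forall>y\<in>A. x \<noteq> y \<longrightarrow> B x \<inter> B y = {} \<and> (\<exists>p\<in>B x. \<exists>q\<in>B y. adj G p q)"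
    using B(2) assms(2) by meson
  ultimately show ?thesis unfolding rooted_clique_model_def by blast
qed

lemma clique_rooted_clique_model:
  assumes "is_clique G A"
  shows "rooted_clique_model G (verts G) A"
  unfolding rooted_clique_model_def
  by (rule exI[of _ "\<lambda>x. {x}"]) (use assms in \<open>auto simp: is_clique_def\<close>)

text \<open>Vertices of \<open>S\<close> become singleton branch sets, disjoint from the old ones
  because they lie outside \<open>V\<close>, and adjacent to the old ones through the roots.\<close>

lemma rooted_clique_model_extend:
  assumes "rooted_clique_model G V A" "A \<subseteq> V" "V \<inter> D = {}" "S \<subseteq> D"
    and S: "\<forall>b\<in>S. \<forall>y\<in>A \<union> S. y \<noteq> b \<longrightarrow> adj G b y"
  shows "rooted_clique_model G (V \<union> D) (A \<union> S)"
proof -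
  obtain B where B: "\<forall>x\<in>A. x \<in> B x \<and> B x \<subseteq> V \<and> connected_set G (B x)"
    "\<forall>x\<in>A. \<forall>y\<in>A. x \<noteq> y \<longrightarrow> B x \<inter> B y = {} \<and> (\<exists>p\<in>B x. \<exists>q\<in>B y. adj G p q)"
    using assms(1) unfolding rooted_clique_model_def by blast
  have AS: "A \<inter> S = {}" using assms(2-4) by blast
  let ?B = "\<lambda>x. if x \<in> S then {x} else B x"
  have A: "x \<in> B x" "B x \<subseteq> V" "connected_set G (B x)" if "x \<in> A" for x
    using B(1) that by auto
  have "x \<in> ?B x \<and> ?B x \<subseteq> V \<union> D \<and> connected_set G (?B x)" if "x \<in> A \<union> S" for x
    using that A[of x] assms(4) by auto
  moreover have "?B x \<inter> ?B y = {} \<and> (\<exists>p\<in>?B x. \<exists>q\<in>?B y. adj G p q)"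
    if x: "x \<in> A \<union> S" and y: "y \<in> A \<union> S" and ne: "x \<noteq> y" for x y
  proof (cases "x \<in> S \<or> y \<in> S")
    case False
    then show ?thesis using x y ne B(2) by simp
  next
    case True
    then have "adj G x y" using S x y ne adj_sym by metis
    moreover have "x \<in> ?B x" "y \<in> ?B y" using x y A by auto
    moreover have "?B x \<inter> ?B y = {}"
      using x y ne A(2)[of x] A(2)[of y] assms(3,4) True by auto
    ultimately show ?thesis by blast
  qed
  ultimately show ?thesis unfolding rooted_clique_model_def by (intro exI[of _ ?B]) blast
qed

lemma rooted_clique_model_minor:
  assumes "rooted_clique_model G (verts G) A" "finite A" "n \<le> card A"
  shows "has_K_minor G n"
proof -
  obtain B where B: "\<forall>x\<in>A. x \<in> B x \<and> B x \<subseteq> verts G \<and> connected_set G (B x)"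
    "\<forall>x\<in>A. \<forall>y\<in>A. x \<noteq> y \<longrightarrow> B x \<inter> B y = {} \<and> (\<exists>p\<in>B x. \<exists>q\<in>B y. adj G p q)"
    using assms(1) unfolding rooted_clique_model_def by blast
  obtain h where h: "bij_betw h {0..<card A} A" using ex_bij_betw_nat_finite[OF assms(2)] by blast
  have hA: "h i \<in> A" if "i < n" for i using h that assms(3) by (auto simp: bij_betw_def)
  have hi: "h i \<noteq> h j" if "i < n" "j < n" "i \<noteq> j" for i j
    using h that assms(3) by (auto simp: bij_betw_def dest: inj_onD)
  show ?thesis unfolding has_K_minor_def
  proof (intro exI[of _ "\<lambda>i. B (h i)"] conjI allI impI)
    fix i assume "i < n"
    then show "B (h i) \<noteq> {}" "B (h i) \<subseteq> verts G" "connected_set G (B (h i))" using B(1) hA by blast+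
  next
    fix i j assume "i < n" "j < n" "i \<noteq> j"
    then show "B (h i) \<inter> B (h j) = {}" "\<exists>x\<in>B (h i). \<exists>y\<in>B (h j). adj G x y" using B(2) hA hi by blast+
  qed
qed

text \<open>The branch set of \<open>u\<close> consists of \<open>u\<close> and, for each new neighbour \<open>w\<close> in the clique, a side of a
  hole through \<open>u\<close> and \<open>w\<close>; the clique \<open>K - {u}\<close> can meet only one of the two sides.\<close>

lemma hatG_clique_rooted_clique_model:
  assumes wf: "wf_graph G" and C: "C \<subseteq> verts G" "NC_set G C"
    and K: "is_clique (hatG G C) K"
  shows "rooted_clique_model G (verts G) K"
proof (cases "is_clique G K")
  case True
  then show ?thesis by (rule clique_rooted_clique_model)
next
  case False
  obtain u where u: "is_clique G (K - {u})" using hatG_clique[OF assms] by blast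
  have uK: "u \<in> K"
  proof (rule ccontr)
    assume "u \<notin> K"
    then have "K - {u} = K" by blast
    then show False using u False by simp
  qed
  have KV: "K \<subseteq> verts G" using K verts_hatG[OF wf C] by (simp add: is_clique_def)
  let ?P = "\<lambda>w Z. connected_set G Z \<and> u \<in> Z \<and> Z \<subseteq> verts G \<and> Z \<inter> (K - {u}) = {} \<and> (\<exists>q\<in>Z. adj G q w)"
  have "\<exists>Z. ?P w Z" if w: "w \<in> K - {u}" for w
  proof (cases "adj G u w")
    case True
    then show ?thesis using uK KV by (intro exI[of _ "{u}"]) auto
  next
    case False
    have "adj (hatG G C) u w" using K w uK by (auto simp: is_clique_def)
    then obtain T where T: "is_hole G T" "u \<in> T" "w \<in> T" using False adj_hatG[OF wf C] by blast
    have ne: "u \<noteq> w" using w by auto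
    obtain A A' s s' x x' where sides: "T = insert u (insert w (A \<union> A'))" "u \<notin> A \<union> A'" "w \<notin> A \<union> A'"
      "connected_set G A" "connected_set G A'" "anticomplete G A A'"
      "{z \<in> A. adj G u z} = {s}" "{z \<in> A'. adj G u z} = {s'}"
      "{z \<in> A. adj G w z} = {x}" "{z \<in> A'. adj G w z} = {x'}"
      by (rule hole_sides[OF T ne False])
    have TV: "T \<subseteq> verts G" using T by (auto simp: is_hole_def)
    have "\<exists>Z. ?P w Z" if X: "connected_set G X" "X \<subseteq> T" "{z \<in> X. adj G u z} = {s}"
      "{z \<in> X. adj G w z} = {x}" "X \<inter> (K - {u}) = {}" for X s x
    proof (intro exI[of _ "insert u X"] conjI)
      have s: "s \<in> X" "adj G u s" using X(3) by blast+
      show "connected_set G (insert u X)" by (rule connected_set_insert[OF X(1) s])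
      have x: "x \<in> X" "adj G w x" using X(4) by blast+
      show "\<exists>q\<in>insert u X. adj G q w" using x(1) adj_sym[OF x(2)] by blast
    qed (use X uK KV TV in auto)
    note side = this
    \<comment> \<open>Clique vertices on opposite sides would be adjacent in \<open>G\<close>, but
      the sides are anticomplete.\<close>
    have "A \<inter> (K - {u}) = {} \<or> A' \<inter> (K - {u}) = {}"
    proof (rule ccontr)
      assume "\<not> ?thesis"
      then obtain p q where "p \<in> A" "p \<in> K - {u}" "q \<in> A'" "q \<in> K - {u}" by blast
      moreover from this have "p \<noteq> q" using sides(6) by (auto simp: anticomplete_def)
      ultimately show False using u sides(6) unfolding is_clique_def anticomplete_def by blast
    qed
    then show ?thesis
    proof
      assume "A \<inter> (K - {u}) = {}"
      then show ?thesis using side[OF sides(4) _ sides(7,9)] sides(1) by blast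
    next
      assume "A' \<inter> (K - {u}) = {}"
      then show ?thesis using side[OF sides(5) _ sides(8,10)] sides(1) by blast
    qed
  qed
  then obtain Z where Z: "\<And>w. w \<in> K - {u} \<Longrightarrow> ?P w (Z w)" by metis
  \<comment> \<open>The extra \<open>{u}\<close> puts \<open>u\<close> into \<open>U\<close> even if
    \<open>K - {u}\<close> is empty.\<close>
  define U where "U = \<Union> (insert {u} (Z ` (K - {u})))"
  have Uc: "connected_set G U" unfolding U_def
    by (rule connected_set_Union_common[of _ G u]) (use Z in auto)
  have uU: "u \<in> U" by (simp add: U_def)
  have UV: "U \<subseteq> verts G" using Z uK KV by (fastforce simp: U_def)
  have UK: "U \<inter> (K - {u}) = {}" using Z by (fastforce simp: U_def)
  have Ua: "\<exists>q\<in>U. adj G q w" if "w \<in> K - {u}" for w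
    using Z[OF that] that unfolding U_def by blast
  let ?B = "\<lambda>x. if x = u then U else {x}"
  have "x \<in> ?B x \<and> ?B x \<subseteq> verts G \<and> connected_set G (?B x)" if "x \<in> K" for x
    using that uU UV Uc KV by auto
  moreover have "?B x \<inter> ?B y = {} \<and> (\<exists>p\<in>?B x. \<exists>q\<in>?B y. adj G p q)"
    if "x \<in> K" "y \<in> K" "x \<noteq> y" for x y
  proof (cases "x = u \<or> y = u")
    case True
    then show ?thesis
    proof
      assume "x = u"
      then show ?thesis using that UK Ua[of y] by auto
    next
      assume "y = u"
      then show ?thesis using that UK Ua[of x] by (auto dest: adj_sym)
    qed
  next
    case False
    then show ?thesis using that u by (auto simp: is_clique_def)
  qed
  ultimately show ?thesis unfolding rooted_clique_model_def by (intro exI[of _ ?B]) blast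
qed

subsection \<open>Local chordalization partitions\<close>

abbreviation lcp_graph :: "'a graph \<Rightarrow> 'a graph \<Rightarrow> 'a set \<Rightarrow> 'a set list \<Rightarrow> 'a graph" where
  "lcp_graph G Gs C Cs \<equiv> (verts Gs \<union> C, edges Gs \<union> edges (delete G (\<Union> (set Cs))))"

lemma verts_lcp_graph: "verts (lcp_graph G Gs C Cs) = verts Gs \<union> C"
  by (simp add: verts_def)

lemma adj_lcp_graph:
  "adj (lcp_graph G Gs C Cs) x y \<longleftrightarrow>
     adj Gs x y \<or> adj G x y \<and> x \<notin> \<Union> (set Cs) \<and> y \<notin> \<Union> (set Cs)"
  by (auto simp: adj_def edges_def delete_def)

lemma wf_lcp_graph:
  assumes "wf_graph G" "wf_graph Gs" "verts Gs \<union> C = verts G - \<Union> (set Cs)"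
  shows "wf_graph (lcp_graph G Gs C Cs)"
proof -
  have fin: "finite (verts Gs \<union> C)" using assms(1,3) by (simp add: wf_graph_def)
  have "\<exists>x y. e = {x, y} \<and> x \<noteq> y \<and> x \<in> verts Gs \<union> C \<and> y \<in> verts Gs \<union> C"
    if "e \<in> edges Gs \<union> edges (delete G (\<Union> (set Cs)))" for e
  proof (cases "e \<in> edges Gs")
    case True
    then show ?thesis using assms(2) unfolding wf_graph_def by blast
  next
    case False
    then have e: "e \<in> edges G" "e \<inter> \<Union> (set Cs) = {}" using that by (auto simp: delete_def edges_def)
    then obtain x y where xy: "e = {x, y}" "x \<noteq> y" "x \<in> verts G" "y \<in> verts G"
      using assms(1) unfolding wf_graph_def by blast
    then have "x \<in> verts Gs \<union> C" "y \<in> verts Gs \<union> C" using e(2) unfolding assms(3) by auto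
    then show ?thesis using xy by blast
  qed
  then show ?thesis using fin by (simp add: wf_graph_def verts_def edges_def)
qed

text \<open>The predicate \<open>P\<close> will be instantiated with cliques and with rooted clique
  models of \<open>G\<close>. After the loss of one vertex, the clique splits into a part in
  \<open>Gs\<close>, handled by the invariant, and a part in \<open>C\<close>, whose edges come from
  \<open>G\<close> and are absorbed by the extension rule.\<close>

lemma lcp_step_clique_bound:
  assumes wf: "wf_graph G" "wf_graph Gs"
    and V: "verts Gs \<union> C = verts G - \<Union> (set Cs)" "verts Gs \<inter> C = {}"
    and sub: "\<And>x y. adj G x y \<Longrightarrow> x \<in> verts Gs \<Longrightarrow> y \<in> verts Gs \<Longrightarrow> adj Gs x y"
    and NC: "NC_set (lcp_graph G Gs C Cs) C"
    and ext: "\<And>A S. P (verts Gs) A \<Longrightarrow> A \<subseteq> verts Gs \<Longrightarrow> S \<subseteq> C \<Longrightarrow>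
       (\<forall>b\<in>S. \<forall>y\<in>A \<union> S. y \<noteq> b \<longrightarrow> adj G b y) \<Longrightarrow> P (verts Gs \<union> C) (A \<union> S)"
    and inv: "\<And>K. is_clique Gs K \<Longrightarrow> \<exists>R\<subseteq>K. card R \<le> r \<and> P (verts Gs) (K - R)"
    and K: "is_clique (hatG (lcp_graph G Gs C Cs) C) K"
  shows "\<exists>R\<subseteq>K. card R \<le> Suc r \<and> P (verts Gs \<union> C) (K - R)"
proof -
  let ?F = "lcp_graph G Gs C Cs"
  have wfF: "wf_graph ?F" by (rule wf_lcp_graph[OF wf V(1)])
  have CF: "C \<subseteq> verts ?F" by (simp add: verts_def)
  obtain u where u: "is_clique ?F (K - {u})" using hatG_clique[OF wfF CF NC K] by blast
  have KV: "K \<subseteq> verts Gs \<union> C"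
    using K verts_hatG[OF wfF CF NC] verts_lcp_graph[where G = G and Gs = Gs and C = C and Cs = Cs] by (simp add: is_clique_def)
  define A where "A = (K - {u}) \<inter> verts Gs"
  define S where "S = (K - {u}) \<inter> C"
  have "is_clique Gs A"
    unfolding is_clique_def
  proof (intro conjI ballI impI)
    fix x y assume xy: "x \<in> A" "y \<in> A" "x \<noteq> y"
    then have "adj ?F x y" using u by (auto simp: is_clique_def A_def)
    then show "adj Gs x y" using sub xy by (auto simp: adj_lcp_graph A_def)
  qed (simp add: A_def)
  then obtain R where R: "R \<subseteq> A" "card R \<le> r" "P (verts Gs) (A - R)" using inv by blast
  have "\<forall>b\<in>S. \<forall>y\<in>(A - R) \<union> S. y \<noteq> b \<longrightarrow> adj G b y"
  proof (intro ballI impI)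
    fix b y assume bS: "b \<in> S" "y \<in> (A - R) \<union> S" "y \<noteq> b"
    then have "adj ?F b y" using u by (auto simp: is_clique_def A_def S_def)
    \<comment> \<open>The vertex \<open>b\<close> is new, so no edge of \<open>Gs\<close> reaches
      it.\<close>
    moreover have "\<not> adj Gs b y" using wf_graph_adjD(1)[OF wf(2), of b y] bS V(2) by (auto simp: S_def)
    ultimately show "adj G b y" by (simp add: adj_lcp_graph)
  qed
  then have P: "P (verts Gs \<union> C) ((A - R) \<union> S)"
    using R by (intro ext) (auto simp: A_def S_def)
  \<comment> \<open>The vertex \<open>u\<close> need not lie in \<open>K\<close>, hence the
    intersection.\<close>
  let ?R = "insert u R \<inter> K"
  have finR: "finite R"
  proof (rule finite_subset)
    show "R \<subseteq> verts Gs" using R by (auto simp: A_def)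
    show "finite (verts Gs)" using wf by (simp add: wf_graph_def)
  qed
  have "card ?R \<le> card (insert u R)" using finR by (intro card_mono) auto
  also have "\<dots> \<le> Suc r" using finR R(2) by (simp add: card_insert_if)
  finally have "card ?R \<le> Suc r" .
  moreover have "K - ?R = (A - R) \<union> S"
    using KV R(1) V(2) by (auto simp: A_def S_def)
  ultimately show ?thesis using P by (intro exI[of _ ?R]) auto
qed

lemma nth_disjoint_ConsD:
  assumes "\<forall>i<length (C # Cs). \<forall>j<length (C # Cs). i \<noteq> j \<longrightarrow> (C # Cs) ! i \<inter> (C # Cs) ! j = {}"
  shows "D \<in> set Cs \<Longrightarrow> C \<inter> D = {}"
    and "\<forall>i<length Cs. \<forall>j<length Cs. i \<noteq> j \<longrightarrow> Cs ! i \<inter> Cs ! j = {}"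
proof -
  assume "D \<in> set Cs"
  then obtain i where "i < length Cs" "Cs ! i = D" by (metis in_set_conv_nth)
  then show "C \<inter> D = {}" using assms[rule_format, of 0 "Suc i"] by simp
next
  show "\<forall>i<length Cs. \<forall>j<length Cs. i \<noteq> j \<longrightarrow> Cs ! i \<inter> Cs ! j = {}"
  proof (intro allI impI)
    fix i j assume "i < length Cs" "j < length Cs" "i \<noteq> j"
    then show "Cs ! i \<inter> Cs ! j = {}" using assms[rule_format, of "Suc i" "Suc j"] by simp
  qed
qed

text \<open>Each part raises the number of lost vertices by one, so \<open>r\<close> varies in the
  induction. An arbitrary starting graph \<open>Gs\<close> lets the minor bound begin after the
  first part.\<close>

lemma lcp_steps_clique_bound:
  assumes wf: "wf_graph G"
    and ext: "\<And>V A D S. P V A \<Longrightarrow> A \<subseteq> V \<Longrightarrow> V \<inter> D = {} \<Longrightarrow> D \<subseteq> verts G \<Longrightarrow> S \<subseteq> D \<Longrightarrow>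
       (\<forall>b\<in>S. \<forall>y\<in>A \<union> S. y \<noteq> b \<longrightarrow> adj G b y) \<Longrightarrow> P (V \<union> D) (A \<union> S)"
    and "lcp_steps G Gs Cs" "wf_graph Gs" "chordal Gs" "verts Gs = verts G - \<Union> (set Cs)"
    and "\<Union> (set Cs) \<subseteq> verts G"
    and "\<forall>i<length Cs. \<forall>j<length Cs. i \<noteq> j \<longrightarrow> Cs ! i \<inter> Cs ! j = {}"
    and "\<And>x y. adj G x y \<Longrightarrow> x \<in> verts Gs \<Longrightarrow> y \<in> verts Gs \<Longrightarrow> adj Gs x y"
    and "\<And>K. is_clique Gs K \<Longrightarrow> \<exists>R\<subseteq>K. card R \<le> r \<and> P (verts Gs) (K - R)"
  shows "\<exists>F. wf_graph F \<and> chordal F \<and> verts F = verts G \<and> (\<forall>x y. adj G x y \<longrightarrow> adj F x y) \<and>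
     (\<forall>K. is_clique F K \<longrightarrow> (\<exists>R\<subseteq>K. card R \<le> r + length Cs \<and> P (verts G) (K - R)))"
  using assms(3-)
proof (induction Cs arbitrary: Gs r)
  case Nil
  have "adj Gs x y" if "adj G x y" for x y
    using Nil.prems(4,7) that wf_graph_adjD[OF wf that] by simp
  then show ?case using Nil.prems by (intro exI[of _ Gs]) simp
next
  case (Cons C Cs)
  let ?F = "lcp_graph G Gs C Cs"
  let ?H = "hatG ?F C"
  have steps: "NC_set ?F C" "chordal ?H" "lcp_steps G ?H Cs"
    using Cons.prems(1) by (simp_all add: Let_def)
  note disj = nth_disjoint_ConsD(1)[OF Cons.prems(6)]
  note disj' = nth_disjoint_ConsD(2)[OF Cons.prems(6)]
  have CG: "C \<subseteq> verts G" "\<Union> (set Cs) \<subseteq> verts G" using Cons.prems(5) by auto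
  have V: "verts Gs \<union> C = verts G - \<Union> (set Cs)" "verts Gs \<inter> C = {}"
    using Cons.prems(4) disj CG by auto
  have wfF: "wf_graph ?F" by (rule wf_lcp_graph[OF wf Cons.prems(2) V(1)])
  have CF: "C \<subseteq> verts ?F" by (simp add: verts_def)
  have wfH: "wf_graph ?H" by (rule wf_hatG[OF wfF CF steps(1)])
  have VH: "verts ?H = verts Gs \<union> C" using verts_hatG[OF wfF CF steps(1)] verts_lcp_graph by metis
  have subH: "adj ?H x y" if "adj G x y" "x \<in> verts ?H" "y \<in> verts ?H" for x y
  proof -
    have "adj ?F x y" using that V(1) unfolding VH adj_lcp_graph by auto
    then show ?thesis using adj_hatG[OF wfF CF steps(1)] by blast
  qed
  have inv: "\<exists>R\<subseteq>K. card R \<le> Suc r \<and> P (verts ?H) (K - R)" if K: "is_clique ?H K" for K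
    unfolding VH
  proof (rule lcp_step_clique_bound[where P = P and r = r, OF wf Cons.prems(2) V Cons.prems(7) steps(1) _ Cons.prems(8) K])
    show "P (verts Gs \<union> C) (A \<union> S)" if "P (verts Gs) A" "A \<subseteq> verts Gs" "S \<subseteq> C"
      "\<forall>b\<in>S. \<forall>y\<in>A \<union> S. y \<noteq> b \<longrightarrow> adj G b y" for A S
      by (rule ext[OF that(1,2) V(2) CG(1) that(3,4)])
  qed
  have VH': "verts ?H = verts G - \<Union> (set Cs)" using VH V(1) by simp
  show ?case
    using Cons.IH[OF steps(3) wfH steps(2) VH' CG(2) disj' subH inv] by simp
qed

text \<open>Adding the vertices one at a time always works: every hole passes through the vertex just added.
  In particular the minimum in the definition of the non-chordality index is attained.\<close>

lemma lcp_steps_singletons: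
  assumes wf: "wf_graph G" and "wf_graph Gs" "chordal Gs" "distinct xs" "set xs \<subseteq> verts G"
    "verts Gs = verts G - set xs"
    and "\<And>x y. adj G x y \<Longrightarrow> x \<in> verts Gs \<Longrightarrow> y \<in> verts Gs \<Longrightarrow> adj Gs x y"
  shows "lcp_steps G Gs (map (\<lambda>x. {x}) xs)"
  using assms(2-)
proof (induction xs arbitrary: Gs)
  case (Cons u xs)
  let ?Cs = "map (\<lambda>x. {x}) xs"
  let ?F = "lcp_graph G Gs {u} ?Cs"
  have Un: "\<Union> (set ?Cs) = set xs" by auto
  have V: "verts Gs \<union> {u} = verts G - \<Union> (set ?Cs)" "u \<notin> verts Gs"
    using Cons.prems unfolding Un by auto
  have wfF: "wf_graph ?F" by (rule wf_lcp_graph[OF wf Cons.prems(1) V(1)])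
  have VF: "verts ?F = verts Gs \<union> {u}" by (rule verts_lcp_graph)
  have uF: "u \<in> verts ?F" unfolding VF by simp
  have hole_u: "u \<in> H" if H: "is_hole ?F H" for H
  proof (rule ccontr)
    assume u: "u \<notin> H"
    have HV: "H \<subseteq> verts Gs \<union> {u}" using H VF by (auto simp: is_hole_def)
    \<comment> \<open>Away from \<open>u\<close> nothing is added to the chordal graph
      \<open>Gs\<close>, so a hole avoiding \<open>u\<close> is impossible.\<close>
    have "adj ?F x y \<longleftrightarrow> adj Gs x y" if "x \<in> H" "y \<in> H" for x y
      using that u HV Cons.prems(6)[of x y] unfolding adj_lcp_graph by blast
    then have "is_hole Gs H" using is_hole_cong[of H ?F Gs] H HV VF u by blast
    then show False using Cons.prems(2) by (auto simp: chordal_def)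
  qed
  have cover: "hole_cover ?F {u}" using hole_u uF by (auto simp: hole_cover_def)
  have NCu: "NC_vertex ?F u" using hole_u by (auto simp: NC_vertex_def)
  have "card (H \<inter> {u}) \<le> 1" for H using card_mono[of "{u}" "H \<inter> {u}"] by simp
  then have NC: "NC_set ?F {u}" using NCu by (simp add: NC_set_def)
  have "(SOME xs. distinct xs \<and> set xs = {u}) = [u]"
  proof (rule some_equality)
    fix ys assume "distinct ys \<and> set ys = {u}"
    then have "length ys = 1" "set ys = {u}" by (auto simp: distinct_card[symmetric])
    then show "ys = [u]" by (cases ys) auto
  qed simp
  then have hat: "hatG ?F {u} = local_chordalize ?F u" by (simp add: hatG_def)
  note hole = is_hole_local_chordalize[OF wfF uF NCu]
  have ch: "chordal (hatG ?F {u})" unfolding hat chordal_def hole using hole_u by blast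
  have uF': "{u} \<subseteq> verts ?F" using uF by simp
  have VH: "verts (hatG ?F {u}) = verts Gs \<union> {u}" using verts_hatG[OF wfF uF' NC] VF by simp
  have "lcp_steps G (hatG ?F {u}) ?Cs"
  proof (rule Cons.IH[OF wf_hatG[OF wfF uF' NC] ch])
    show "distinct xs" "set xs \<subseteq> verts G" using Cons.prems by auto
    show "verts (hatG ?F {u}) = verts G - set xs" using VH V(1) Un by simp
    fix x y assume xy: "adj G x y" "x \<in> verts (hatG ?F {u})" "y \<in> verts (hatG ?F {u})"
    then have "adj ?F x y" using V(1) unfolding VH adj_lcp_graph by auto
    then show "adj (hatG ?F {u}) x y" using adj_hatG[OF wfF uF' NC] by blast
  qed
  then show ?case using cover NC ch by (simp add: Let_def)
qed simp

section \<open>The graph without the hole cover, and attainment of the index\<close>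

lemma wf_delete:
  assumes "wf_graph G"
  shows "wf_graph (delete G S)"
  unfolding wf_graph_def
proof (intro conjI ballI)
  show "finite (verts (delete G S))" using assms by (simp add: wf_graph_def delete_def verts_def)
  fix e assume "e \<in> edges (delete G S)"
  then have e: "e \<in> edges G" "e \<inter> S = {}" by (auto simp: delete_def edges_def)
  then obtain u v where uv: "e = {u, v}" "u \<noteq> v" "u \<in> verts G" "v \<in> verts G"
    using assms unfolding wf_graph_def by blast
  then have "u \<in> verts (delete G S)" "v \<in> verts (delete G S)"
    using e(2) by (auto simp: delete_def verts_def)
  then show "\<exists>u v. e = {u, v} \<and> u \<noteq> v \<and> u \<in> verts (delete G S) \<and> v \<in> verts (delete G S)"
    using uv by blast
qed

lemma verts_delete: "verts (delete G S) = verts G - S"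
  by (simp add: delete_def verts_def)

lemma adj_delete: "adj (delete G S) x y \<longleftrightarrow> adj G x y \<and> x \<notin> S \<and> y \<notin> S"
  by (auto simp: adj_def delete_def edges_def)

text \<open>A hole of an induced subgraph is a hole of \<open>G\<close>, and here it would miss the
  cover.\<close>

lemma chordal_delete_hole_cover:
  assumes "hole_cover G C"
  shows "chordal (delete G C)"
  unfolding chordal_def
proof
  assume "\<exists>H. is_hole (delete G C) H"
  then obtain H where H: "is_hole (delete G C) H" by blast
  then have HV: "H \<subseteq> verts G - C" by (auto simp: is_hole_def verts_delete)
  then have "is_hole (delete G C) H \<longleftrightarrow> is_hole G H"
    by (intro is_hole_cong) (auto simp: adj_delete verts_delete)
  then show False using H HV assms unfolding hole_cover_def by blast
qed

lemma non_chordality_index_partition: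
  assumes wf: "wf_graph G" and nc: "\<not> chordal G"
  obtains C Cs where "hole_cover G C" "local_chordalization_partition G C Cs"
    "length Cs = non_chordality_index G"
proof -
  obtain xs where xs: "set xs = verts G" "distinct xs"
    using wf finite_distinct_list[of "verts G"] by (auto simp: wf_graph_def)
  obtain H where H: "is_hole G H" using nc by (auto simp: chordal_def)
  have hne: "H' \<subseteq> verts G \<and> H' \<noteq> {}" if "is_hole G H'" for H' using that by (auto simp: is_hole_def)
  then have cover: "hole_cover G (verts G)" using H unfolding hole_cover_def by blast
  let ?Cs = "map (\<lambda>x. {x}) xs"
  have "lcp_steps G (delete G (verts G)) ?Cs"
    by (rule lcp_steps_singletons[OF wf wf_delete[OF wf] chordal_delete_hole_cover[OF cover]])
      (use xs in \<open>auto simp: verts_delete\<close>)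
  moreover have "xs \<noteq> []" using xs hne[OF H] by auto
  ultimately have "local_chordalization_partition G (verts G) ?Cs"
    using xs by (auto simp: local_chordalization_partition_def nth_eq_iff_index_eq)
  then have "\<exists>l C Cs. hole_cover G C \<and> local_chordalization_partition G C Cs \<and> length Cs = l"
    using cover by blast
  from LeastI_ex[OF this] show ?thesis using that nc by (auto simp: non_chordality_index_def)
qed

section \<open>From clique sizes to bounds on the DP-chromatic number\<close>

lemma chi_DP_le_chordal_supergraph:
  assumes "wf_graph F" "chordal F" "verts F = verts G" "\<And>x y. adj G x y \<Longrightarrow> adj F x y"
    and "\<And>K. is_clique F K \<Longrightarrow> card K \<le> k"
  shows "chi_DP G \<le> k"
proof -
  have "dp_colorable F k" by (rule chordal_dp_colorable[OF assms(1,2,5)])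
  then have "dp_colorable G k" by (rule dp_colorable_subgraph) (use assms in auto)
  then show ?thesis unfolding chi_DP_def by (rule Least_le)
qed

lemma card_clique_le_clique_number:
  assumes "wf_graph G" "is_clique G K"
  shows "card K \<le> clique_number G"
proof -
  have "{card K |K. is_clique G K} \<subseteq> card ` Pow (verts G)" by (auto simp: is_clique_def)
  moreover have "finite (verts G)" using assms by (simp add: wf_graph_def)
  ultimately have "finite {card K |K. is_clique G K}" using finite_subset by blast
  then show ?thesis unfolding clique_number_def using assms(2) by (intro Max_ge) auto
qed

lemma card_diff_bound:
  assumes "finite K" "R \<subseteq> K" "card R \<le> r" "card (K - R) \<le> m"
  shows "card K \<le> m + r"
proof -
  have "card K = card (K - R) + card R"
    using assms(1,2) by (metis card_Diff_subset card_mono finite_subset le_add_diff_inverse2)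
  then show ?thesis using assms(3,4) by linarith
qed

theorem theorem4p1:
  fixes G :: "'a graph"
  assumes "wf_graph G"
  shows "chi_DP G \<le> clique_number G + non_chordality_index G \<and>
         (\<forall>n::nat. \<not> chordal G \<and> \<not> has_K_minor G n \<longrightarrow>
              chi_DP G \<le> n - 2 + non_chordality_index G)"
proof (cases "chordal G")
  case True
  have "chi_DP G \<le> clique_number G"
    by (rule chi_DP_le_chordal_supergraph[OF assms True])
      (auto intro: card_clique_le_clique_number[OF assms])
  then show ?thesis using True by (simp add: non_chordality_index_def)
next
  case False
  obtain \<C> Cs where cover: "hole_cover G \<C>" and part: "local_chordalization_partition G \<C> Cs"
    and len: "length Cs = non_chordality_index G"
    by (rule non_chordality_index_partition[OF assms False])
  have Un: "\<Union> (set Cs) = \<C>" and steps: "lcp_steps G (delete G \<C>) Cs" and Cs: "Cs \<noteq> []"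
    and disj: "\<forall>i<length Cs. \<forall>j<length Cs. i \<noteq> j \<longrightarrow> Cs ! i \<inter> Cs ! j = {}"
    using part unfolding local_chordalization_partition_def by auto
  have UG: "\<Union> (set Cs) \<subseteq> verts G" using cover Un by (auto simp: hole_cover_def)
  have fin: "finite (verts G)" using assms by (simp add: wf_graph_def)
  let ?G0 = "delete G \<C>"
  have wf0: "wf_graph ?G0" by (rule wf_delete[OF assms])
  have ch0: "chordal ?G0" by (rule chordal_delete_hole_cover[OF cover])
  have V0: "verts ?G0 = verts G - \<Union> (set Cs)" by (simp add: verts_delete Un)
  have sub0: "adj ?G0 x y" if "adj G x y" "x \<in> verts ?G0" "y \<in> verts ?G0" for x y
    using that by (auto simp: adj_delete verts_delete)

  \<comment> \<open>For the clique bound, the recursion starts at \<open>?G0\<close>, whose cliques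
    are cliques of \<open>G\<close> with no vertex lost.\<close>
  have "\<exists>F. wf_graph F \<and> chordal F \<and> verts F = verts G \<and> (\<forall>x y. adj G x y \<longrightarrow> adj F x y) \<and>
     (\<forall>K. is_clique F K \<longrightarrow> (\<exists>R\<subseteq>K. card R \<le> 0 + length Cs \<and> is_clique G (K - R)))"
  proof (rule lcp_steps_clique_bound[where P = "\<lambda>V. is_clique G", OF assms _ steps wf0 ch0 V0 UG disj sub0])
    show "is_clique G (A \<union> S)" if "is_clique G A" "D \<subseteq> verts G" "S \<subseteq> D"
      "\<forall>b\<in>S. \<forall>y\<in>A \<union> S. y \<noteq> b \<longrightarrow> adj G b y" for A D S :: "'a set"
      unfolding is_clique_def
    proof (intro conjI ballI impI)
      show "A \<union> S \<subseteq> verts G" using that by (auto simp: is_clique_def)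
      fix x y assume "x \<in> A \<union> S" "y \<in> A \<union> S" "x \<noteq> y"
      then show "adj G x y"
        using that(1) that(4)[rule_format, of x y] that(4)[rule_format, of y x] adj_sym[of G y x]
        by (auto simp: is_clique_def)
    qed
    show "\<exists>R\<subseteq>K. card R \<le> 0 \<and> is_clique G (K - R)" if "is_clique ?G0 K" for K
      using that by (intro exI[of _ "{}"]) (auto simp: is_clique_def adj_delete verts_delete)
  qed
  then obtain F where F: "wf_graph F" "chordal F" "verts F = verts G" "\<And>x y. adj G x y \<Longrightarrow> adj F x y"
    "\<And>K. is_clique F K \<Longrightarrow> \<exists>R\<subseteq>K. card R \<le> length Cs \<and> is_clique G (K - R)" by auto
  have first: "chi_DP G \<le> clique_number G + non_chordality_index G"
  proof (rule chi_DP_le_chordal_supergraph[OF F(1-4)])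
    fix K assume K: "is_clique F K"
    obtain R where R: "R \<subseteq> K" "card R \<le> length Cs" "is_clique G (K - R)" using F(5)[OF K] by blast
    have "finite K" using K F(3) fin by (auto simp: is_clique_def intro: finite_subset)
    then show "card K \<le> clique_number G + non_chordality_index G"
      using card_diff_bound[OF _ R(1,2) card_clique_le_clique_number[OF assms R(3)]] len by simp
  qed

  \<comment> \<open>For the minor bound, the first part is treated separately: its cliques give
    rooted models without loss, so only the parts in \<open>Cs'\<close> cost a vertex.\<close>
  obtain C Cs' where CCs: "Cs = C # Cs'" using Cs by (cases Cs) auto
  let ?G1 = "lcp_graph G ?G0 C Cs'"
  let ?H = "hatG ?G1 C"
  have s1: "NC_set ?G1 C" "chordal ?H" "lcp_steps G ?H Cs'"
    using steps unfolding CCs by (simp_all add: Let_def)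
  note C0 = nth_disjoint_ConsD(1)[OF disj[unfolded CCs]]
  note disj' = nth_disjoint_ConsD(2)[OF disj[unfolded CCs]]
  have CG: "C \<subseteq> verts G" "\<Union> (set Cs') \<subseteq> verts G" using UG CCs by auto
  have V1: "verts ?G0 \<union> C = verts G - \<Union> (set Cs')"
    using V0 C0 CG unfolding CCs by auto
  have wf1: "wf_graph ?G1" by (rule wf_lcp_graph[OF assms wf0 V1])
  have CF: "C \<subseteq> verts ?G1" by (simp add: verts_def)
  have wfH: "wf_graph ?H" by (rule wf_hatG[OF wf1 CF s1(1)])
  have VG1: "verts ?G1 = verts ?H" using verts_hatG[OF wf1 CF s1(1)] by simp
  have VH: "verts ?H = verts G - \<Union> (set Cs')"
    using VG1 verts_lcp_graph[where G = G and Gs = ?G0 and C = C and Cs = Cs'] V1 by simp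
  have subH: "adj ?H x y" if "adj G x y" "x \<in> verts ?H" "y \<in> verts ?H" for x y
  proof -
    have "adj ?G1 x y" using that unfolding VH adj_lcp_graph by auto
    then show ?thesis using adj_hatG[OF wf1 CF s1(1)] by blast
  qed
  \<comment> \<open>No edges have been added before the first chordalization, so models in
    \<open>?G1\<close> are models in \<open>G\<close>.\<close>
  have G1G: "adj G x y" if "adj ?G1 x y" for x y
    using that unfolding adj_lcp_graph adj_delete by blast
  have inv1: "\<exists>R\<subseteq>K. card R \<le> 0 \<and> rooted_clique_model G (verts ?H) (K - R)" if K: "is_clique ?H K" for K
    using rooted_clique_model_mono_graph[OF hatG_clique_rooted_clique_model[OF wf1 CF s1(1) K] G1G]
    unfolding VG1 by (intro exI[of _ "{}"]) simp
  have "\<exists>F. wf_graph F \<and> chordal F \<and> verts F = verts G \<and> (\<forall>x y. adj G x y \<longrightarrow> adj F x y) \<and>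
     (\<forall>K. is_clique F K \<longrightarrow> (\<exists>R\<subseteq>K. card R \<le> 0 + length Cs' \<and> rooted_clique_model G (verts G) (K - R)))"
  proof (rule lcp_steps_clique_bound[where P = "rooted_clique_model G",
        OF assms _ s1(3) wfH s1(2) VH CG(2) disj' subH inv1])
    show "rooted_clique_model G (V \<union> D) (A \<union> S)" if "rooted_clique_model G V A" "A \<subseteq> V" "V \<inter> D = {}"
      "S \<subseteq> D" "\<forall>b\<in>S. \<forall>y\<in>A \<union> S. y \<noteq> b \<longrightarrow> adj G b y" for V A D S
      by (rule rooted_clique_model_extend[OF that])
  qed
  then obtain F where F: "wf_graph F" "chordal F" "verts F = verts G" "\<And>x y. adj G x y \<Longrightarrow> adj F x y"
    "\<And>K. is_clique F K \<Longrightarrow> \<exists>R\<subseteq>K. card R \<le> length Cs' \<and> rooted_clique_model G (verts G) (K - R)" by auto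
  have "chi_DP G \<le> n - 2 + non_chordality_index G" if n: "\<not> has_K_minor G n" for n
  proof (rule chi_DP_le_chordal_supergraph[OF F(1-4)])
    obtain v where v: "v \<in> verts G" using cover by (auto simp: hole_cover_def)
    have "is_clique G {v}" using v by (simp add: is_clique_def)
    \<comment> \<open>A single vertex is already a model for \<open>n \<le> 1\<close>. With
      \<open>n \<ge> 2\<close> the subtraction is exact: \<open>n - 1\<close> plus the length of
      \<open>Cs'\<close> equals \<open>n - 2\<close> plus the length of \<open>Cs\<close>.\<close>
    then have "n \<ge> 2"
      using n rooted_clique_model_minor[OF clique_rooted_clique_model, of G "{v}" n] by fastforce
    fix K assume K: "is_clique F K"
    obtain R where R: "R \<subseteq> K" "card R \<le> length Cs'" "rooted_clique_model G (verts G) (K - R)"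
      using F(5)[OF K] by blast
    have finK: "finite K" using K F(3) fin by (auto simp: is_clique_def intro: finite_subset)
    have "card (K - R) < n"
      using n rooted_clique_model_minor[OF R(3), of n] finK by (meson finite_Diff not_less)
    then have "card (K - R) \<le> n - 1" by simp
    then have "card K \<le> n - 1 + length Cs'" by (rule card_diff_bound[OF finK R(1,2)])
    then show "card K \<le> n - 2 + non_chordality_index G"
      using len \<open>n \<ge> 2\<close> unfolding CCs by simp
  qed
  then show ?thesis using first by blast
qed

end
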